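(* Let $\mathbb{K}$ be a field of characteristic $0$, let $A=A(\alpha,\beta,0)$ be a down-up algebra with $(\alpha,\beta)\neq(0,0)$ such that the roots $r_1,r_2$ of $t^2-\alpha t-\beta$ lie in $\mathbb{K}$, labelled so that $r_1\neq0$, and for $l=1,2$ let $w_l=\beta ud+r_ldu$. (1) If $A$ belongs to (F1), then $HH_3(A)$ vanishes. (2) If $A$ belongs to (F2), then $HH_3(A)$ has a basis formed by the classes of the elements of the set - $\{w_1^{2i}w_2^{2i}|d^2u^2 : i\ge0\}$ if $r_1$ is not a root of unity; - $\{w_1^iw_2^ju^{nk}d^{nl}|d^2u^2 : i,j,k,l\ge0,\ n\mid i-j,\ kl=0\}$ if $r_1$ is a primitive $n$-th root of unity with $n\ge3$; - $\{w_1^{2i}|d^2u^2 : i\ge0\}$ if $r_1=-1$; - $\{w_1^i|d^2u^2 : i\ge0\}$ if $r_1=1$.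
   Context: The down-up algebra $A=A(\alpha,\beta,0)$ over a field $\mathbb{K}$ of characteristic $0$ is the quotient of $\mathbb{K}\langle u,d\rangle$ by the relations $d^2u=\alpha dud+\beta ud^2$ and $du^2=\alpha udu+\beta u^2d$. With $r_1,r_2$ the roots of $t^2-\alpha t-\beta$: (F1) $(\alpha,\beta)\neq(0,0)$ and $r_1^ir_2^j\neq1$ for all $i$ and $j$ such that $(i,j)\neq(0,0)$; (F2) $\beta=-1$, in which case $r_2=r_1^{-1}$. Let $V=\mathrm{span}\{d,u\}$, $R=\mathrm{span}\{d^2u,du^2\}\subset V^{\otimes3}$, $\Omega=\mathrm{span}\{d^2u^2\}\subset V^{\otimes4}$, and write $a|x$ for $a\otimes x$. The Hochschild homology of $A$ is computed by a complex $0\to A\otimes\Omega\xrightarrow{d_3}A\otimes R\xrightarrow{d_2}A\otimes V\xrightarrow{d_1}A\to0$ (obtained from the length-$3$ projective bimodule resolution $A\otimes\Omega\otimes A\to A\otimes R\otimes A\to A\otimes V\otimes A\to A\otimes A$ of $A$), whose differential $d_3$ is $$d_3(a|d^2u^2)=-(ua+\beta au)|d^2u+(ad+\beta da)|du^2.$$ In particular $HH_3(A)=\ker d_3\subseteq A\otimes\Omega$.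
   Formalization: In (2), if r_1 is not a root of unity, the basis proved is {w_1^i w_2^i|d^2u^2 : i>=0} instead of the printed {w_1^{2i}w_2^{2i}|d^2u^2}; the printed set does not span, since w_1w_2 is central and w_1w_2|d^2u^2 is a cycle outside its span. *)

theory Defs
  imports "Jordan_Normal_Form.VS_Connect" "HOL-Library.Poly_Mapping"
    "HOL-Algebra.QuotRing" "HOL-Computational_Algebra.Polynomial"
begin

subsection \<open>The free algebra on \<open>u\<close> and \<open>d\<close>\<close>

datatype letter = Up | Down

text \<open>
  Words are wrapped lists, so that the free monoid can be made an instance of
  \<^class>\<open>monoid_add\<close>, with concatenation as addition.  The type of finitely supported functions from
  words to \<open>'k\<close>, with the library's convolution product, is then the free algebra
  \<open>'k\<langle>u,d\<rangle>\<close>.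
\<close>

datatype word = Word "letter list"

instantiation word :: monoid_add
begin

definition zero_word :: word where
  "zero_word = Word []"

fun plus_word :: "word \<Rightarrow> word \<Rightarrow> word" where
  "plus_word (Word v) (Word w) = Word (v @ w)"

instance
proof
  fix a b c :: word
  show "a + b + c = a + (b + c)"
    by (cases a; cases b; cases c) simp
  show "0 + a = a" and "a + 0 = a"
    by (cases a; simp add: zero_word_def)+
qed

end

type_synonym 'k free_alg = "word \<Rightarrow>\<^sub>0 'k"

definition fconst :: "'k \<Rightarrow> 'k::field_char_0 free_alg" where
  "fconst c = Poly_Mapping.single 0 c"

definition fu :: "'k::field_char_0 free_alg" where
  "fu = Poly_Mapping.single (Word [Up]) 1"

definition fd :: "'k::field_char_0 free_alg" where
  "fd = Poly_Mapping.single (Word [Down]) 1"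

subsection \<open>The down-up algebra \<open>A(\<alpha>,\<beta>,0)\<close>\<close>

definition du_relators :: "'k \<Rightarrow> 'k \<Rightarrow> 'k::field_char_0 free_alg set" where
  "du_relators \<alpha> \<beta> =
    {fd * fd * fu - (fconst \<alpha> * (fd * fu * fd) + fconst \<beta> * (fu * fd * fd)),
     fd * fu * fu - (fconst \<alpha> * (fu * fd * fu) + fconst \<beta> * (fu * fu * fd))}"

definition du_ideal :: "'k \<Rightarrow> 'k \<Rightarrow> 'k::field_char_0 free_alg set" where
  "du_ideal \<alpha> \<beta> = Idl\<^bsub>class_ring\<^esub> (du_relators \<alpha> \<beta>)"

definition du_class :: "'k \<Rightarrow> 'k \<Rightarrow> 'k::field_char_0 free_alg \<Rightarrow> 'k free_alg set" where
  "du_class \<alpha> \<beta> x = du_ideal \<alpha> \<beta> +>\<^bsub>class_ring\<^esub> x"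

text \<open>
  The quotient ring by the two-sided ideal, together with the scalar action of \<open>'k\<close> through the
  classes of the constants.
\<close>

definition down_up_algebra :: "'k \<Rightarrow> 'k \<Rightarrow> ('k, 'k::field_char_0 free_alg set) module" where
  "down_up_algebra \<alpha> \<beta> = (let Q = class_ring Quot du_ideal \<alpha> \<beta> in
    \<lparr> carrier = carrier Q, mult = mult Q, one = one Q, zero = zero Q, add = add Q,
      smult = (\<lambda>c x. du_class \<alpha> \<beta> (fconst c) \<otimes>\<^bsub>Q\<^esub> x) \<rparr>)"

definition du_u :: "'k \<Rightarrow> 'k \<Rightarrow> 'k::field_char_0 free_alg set" where
  "du_u \<alpha> \<beta> = du_class \<alpha> \<beta> fu"

definition du_d :: "'k \<Rightarrow> 'k \<Rightarrow> 'k::field_char_0 free_alg set" where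
  "du_d \<alpha> \<beta> = du_class \<alpha> \<beta> fd"

definition du_w :: "'k \<Rightarrow> 'k \<Rightarrow> 'k \<Rightarrow> 'k::field_char_0 free_alg set" where
  "du_w \<alpha> \<beta> r = (let A = down_up_algebra \<alpha> \<beta>; u = du_u \<alpha> \<beta>; d = du_d \<alpha> \<beta> in
    \<beta> \<odot>\<^bsub>A\<^esub> (u \<otimes>\<^bsub>A\<^esub> d) \<oplus>\<^bsub>A\<^esub> r \<odot>\<^bsub>A\<^esub> (d \<otimes>\<^bsub>A\<^esub> u))"

text \<open>
  For a root \<open>r\<close> of \<open>t\<^sup>2 - \<alpha>t - \<beta>\<close> one has \<open>w u = r u w\<close> and \<open>d w = r w d\<close>, and the elements \<open>w\<^sub>1\<close>, \<open>w\<^sub>2\<close>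
  of the two roots commute.  If \<open>r\<^sub>1 r\<^sub>2 = 1\<close> then \<open>w\<^sub>1 w\<^sub>2\<close> is therefore central, so for \<open>\<beta> = -1\<close> every
  power \<open>w\<^sub>1\<^sup>i w\<^sub>2\<^sup>i\<close> gives a cycle in degree three, not only those with \<open>i\<close> even.  This is why the
  basis for \<open>r\<^sub>1\<close> not a root of unity runs over all \<open>i\<close>, where the source prints the exponent \<open>2i\<close>.
\<close>

subsection \<open>Hochschild homology in degree three\<close>

text \<open>
  For a finite set \<open>B\<close> of words and \<open>W = span B\<close> inside the tensor algebra of
  \<open>V = span {d, u}\<close>, the set \<open>B\<close> is a basis of \<open>W\<close>, so the tensor product of \<open>A\<close> with \<open>W\<close> is the
  space of functions from words to \<open>A\<close> that vanish outside \<open>B\<close>; the elementary tensor of \<open>a\<close> and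
  \<open>x \<in> B\<close> is the function with value \<open>a\<close> at \<open>x\<close> and zero elsewhere.  Only the vector space
  structure is meaningful: the ring multiplication fields of the record are left unspecified.
\<close>

definition tensor_words ::
  "('k, 'a) module \<Rightarrow> word set \<Rightarrow> ('k, word \<Rightarrow> 'a) module" where
  "tensor_words A B =
    \<lparr> carrier = {f. (\<forall>x\<in>B. f x \<in> carrier A) \<and> (\<forall>x. x \<notin> B \<longrightarrow> f x = \<zero>\<^bsub>A\<^esub>)},
      mult = undefined, one = undefined,
      zero = (\<lambda>x. \<zero>\<^bsub>A\<^esub>), add = (\<lambda>f g x. f x \<oplus>\<^bsub>A\<^esub> g x),
      smult = (\<lambda>c f x. c \<odot>\<^bsub>A\<^esub> f x) \<rparr>"

definition pure_tensor :: "('k, 'a) module \<Rightarrow> 'a \<Rightarrow> word \<Rightarrow> word \<Rightarrow> 'a" where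
  "pure_tensor A a x = (\<lambda>y. if y = x then a else \<zero>\<^bsub>A\<^esub>)"

definition ddu :: word where "ddu = Word [Down, Down, Up]"
definition duu :: word where "duu = Word [Down, Up, Up]"
definition dduu :: word where "dduu = Word [Down, Down, Up, Up]"

definition A_Omega :: "'k \<Rightarrow> 'k \<Rightarrow> ('k, word \<Rightarrow> 'k::field_char_0 free_alg set) module" where
  "A_Omega \<alpha> \<beta> = tensor_words (down_up_algebra \<alpha> \<beta>) {dduu}"

definition A_R :: "'k \<Rightarrow> 'k \<Rightarrow> ('k, word \<Rightarrow> 'k::field_char_0 free_alg set) module" where
  "A_R \<alpha> \<beta> = tensor_words (down_up_algebra \<alpha> \<beta>) {ddu, duu}"

text \<open>Every element of \<open>A \<otimes> \<Omega>\<close> is the elementary tensor of its value at \<open>d\<^sup>2u\<^sup>2\<close> and \<open>d\<^sup>2u\<^sup>2\<close>.\<close>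

definition diff3 :: "'k \<Rightarrow> 'k \<Rightarrow>
    (word \<Rightarrow> 'k::field_char_0 free_alg set) \<Rightarrow> (word \<Rightarrow> 'k free_alg set)" where
  "diff3 \<alpha> \<beta> f =
    (let A = down_up_algebra \<alpha> \<beta>; u = du_u \<alpha> \<beta>; d = du_d \<alpha> \<beta>; a = f dduu in
      pure_tensor A (\<ominus>\<^bsub>A\<^esub> (u \<otimes>\<^bsub>A\<^esub> a \<oplus>\<^bsub>A\<^esub> \<beta> \<odot>\<^bsub>A\<^esub> (a \<otimes>\<^bsub>A\<^esub> u))) ddu
      \<oplus>\<^bsub>A_R \<alpha> \<beta>\<^esub>
      pure_tensor A (a \<otimes>\<^bsub>A\<^esub> d \<oplus>\<^bsub>A\<^esub> \<beta> \<odot>\<^bsub>A\<^esub> (d \<otimes>\<^bsub>A\<^esub> a)) duu)"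

text \<open>
  The complex has length three, so its homology in degree three is the kernel of the leftmost
  differential, and a class is the same thing as a cycle.
\<close>

definition HH3 :: "'k \<Rightarrow> 'k \<Rightarrow> ('k, word \<Rightarrow> 'k::field_char_0 free_alg set) module" where
  "HH3 \<alpha> \<beta> = (A_Omega \<alpha> \<beta>)
    \<lparr> carrier := {f \<in> carrier (A_Omega \<alpha> \<beta>). diff3 \<alpha> \<beta> f = \<zero>\<^bsub>A_R \<alpha> \<beta>\<^esub>} \<rparr>"

definition Omega_tensor :: "'k \<Rightarrow> 'k \<Rightarrow>
    'k::field_char_0 free_alg set \<Rightarrow> word \<Rightarrow> 'k free_alg set" where
  "Omega_tensor \<alpha> \<beta> a = pure_tensor (down_up_algebra \<alpha> \<beta>) a dduu"

subsection \<open>The families (F1) and (F2)\<close>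

text \<open>
  The exponents in (F1) are natural numbers.  The root \<open>r\<^sub>2\<close> may be zero there; the convention
  \<open>0 ^ 0 = 1\<close> is the intended one.
\<close>

definition family_F1 :: "'k \<Rightarrow> 'k \<Rightarrow> 'k \<Rightarrow> 'k::field_char_0 \<Rightarrow> bool" where
  "family_F1 \<alpha> \<beta> r1 r2 \<longleftrightarrow> (\<alpha>, \<beta>) \<noteq> (0, 0) \<and>
    (\<forall>i j :: nat. (i, j) \<noteq> (0, 0) \<longrightarrow> r1 ^ i * r2 ^ j \<noteq> 1)"

definition family_F2 :: "'k::field_char_0 \<Rightarrow> bool" where
  "family_F2 \<beta> \<longleftrightarrow> \<beta> = - 1"

definition root_of_unity :: "'k::field_char_0 \<Rightarrow> bool" where
  "root_of_unity r \<longleftrightarrow> (\<exists>n::nat. n > 0 \<and> r ^ n = 1)"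

definition primitive_root_of_unity :: "nat \<Rightarrow> 'k::field_char_0 \<Rightarrow> bool" where
  "primitive_root_of_unity n r \<longleftrightarrow>
    n > 0 \<and> r ^ n = 1 \<and> (\<forall>m. 0 < m \<and> m < n \<longrightarrow> r ^ m \<noteq> 1)"

end

theory Submission
  imports Defs "HOL-Library.Function_Algebras"
begin

text \<open>
  A cycle of degree three is an element \<open>a\<close> with \<open>ua = -\<beta>au\<close> and \<open>ad = -\<beta>da\<close>.  If \<open>\<beta> \<noteq> 0\<close>, the algebra
  embeds into a skew Laurent ring \<open>Q[t, t\<^sup>-\<^sup>1; \<sigma>]\<close> over a polynomial ring \<open>Q\<close> in two variables, by
  \<open>u \<mapsto> t\<close> and \<open>d \<mapsto> y t\<^sup>-\<^sup>1\<close> with \<open>y = du\<close>; injectivity follows from the spanning set \<open>w\<^sup>i x\<^sup>j u\<^sup>k\<close>,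
  \<open>w\<^sup>i x\<^sup>j d\<^sup>k\<close>.  In terms of the coefficients \<open>f\<^sub>n\<close> of \<open>t\<^sup>n\<close> the two conditions become \<open>\<sigma>(f\<^sub>n) = -\<beta>f\<^sub>n\<close>
  and \<open>f\<^sub>n = 0\<close> or \<open>\<sigma>\<^sup>n(y) = y\<close>.  For distinct roots \<open>\<sigma>\<close> is diagonal in \<open>w\<^sub>1, w\<^sub>2\<close> with eigenvalues
  \<open>1/r\<^sub>1, 1/r\<^sub>2\<close>; for a double root it is triangular in \<open>w\<^sub>1, ud\<close>, and if \<open>r\<^sub>1\<^sup>2 = 1\<close> its square is the
  translation \<open>ud \<mapsto> ud - 2w\<^sub>1\<close>.  If \<open>\<beta> = 0\<close>, left multiplication by \<open>u\<close> is already injective.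
\<close>

section \<open>The free algebra and its representations\<close>

text \<open>No confluence argument for the relations is needed: the normal monomials span because
  their span is stable under left multiplication by u and d, and they are independent because their
  images in the Laurent ring are visibly so. The same two facts make the embedding faithful. The
  coefficient ring is a domain, so a nonzero factor such as \<open>Y 0\<close> can be cancelled. But
  y is not invertible there: d^k maps to a multiple of t^(-k), and the extra factor
  \<open>cf n\<close> has to be shown \<sigma>-invariant in the admissible degrees before the
  eigenvector problem concerns monomials in w and x only. Since -\<beta> = r1 r2, a diagonal
  eigenvector with exponents i, j exists only if r1^(i+1) r2^(j+1) = 1, which (F1) forbids; at
  \<beta> = -1 eigenvectors become \<sigma>-invariants. For a double root w1 and w2 coincide, so ud
  has to replace w2. The Jordan block puts a term linear in n into \<sigma>^n(y), which leaves only
  n = 0; hence no powers of u or d survive for r1 = 1 and r1 = -1, although these are roots of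
  unity. For \<beta> = 0 the map \<sigma> has no inverse and the construction breaks down.\<close>

lemma fconst_zero [simp]: "fconst 0 = 0"
  and fconst_one [simp]: "fconst 1 = 1"
  by (simp_all add: fconst_def)

lemma fconst_add: "fconst (a + b) = fconst a + fconst b"
  and fconst_diff: "fconst (a - b) = fconst a - fconst b"
  and fconst_uminus: "fconst (- a) = - fconst a"
  by (simp_all add: fconst_def single_add single_diff single_uminus)

lemma fconst_mult: "fconst (a * b) = fconst a * fconst b"
  by (simp add: fconst_def mult_single)

lemma fconst_mult_single: "fconst c * Poly_Mapping.single w a = Poly_Mapping.single w (c * a)"
  by (simp add: fconst_def mult_single)

lemma free_alg_single_induct [case_names single add]:
  fixes x :: "'k::field_char_0 free_alg"
  assumes single: "\<And>w c. P (Poly_Mapping.single w c)"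
    and add: "\<And>x y. P x \<Longrightarrow> P y \<Longrightarrow> P (x + y)"
  shows "P x"
proof (induction x rule: update_induct)
  case const
  then show ?case using single[of 0 0] by simp
next
  case (update f a b)
  have "Poly_Mapping.update a b f = f + Poly_Mapping.single a b"
    using update(1)
    by (intro poly_mapping_eqI) (auto simp: lookup_update lookup_add lookup_single when_def in_keys_iff)
  then show ?case using add[OF update(3) single] by simp
qed

lemma fconst_commute: "x * fconst c = fconst c * x"
proof (induction x rule: free_alg_single_induct)
  case (single w a)
  then show ?case by (simp add: fconst_def mult_single mult.commute)
qed (simp add: algebra_simps)

lemma fconst_left_commute: "x * (fconst c * y) = fconst c * (x * y)"
  by (metis fconst_commute mult.assoc)

definition fletter :: "letter \<Rightarrow> 'k::field_char_0 free_alg" where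
  "fletter l = (case l of Up \<Rightarrow> fu | Down \<Rightarrow> fd)"

lemma single_Cons:
  "Poly_Mapping.single (Word (l # ls)) c = fletter l * Poly_Mapping.single (Word ls) c"
  by (cases l) (simp_all add: fletter_def fu_def fd_def mult_single)

text \<open>Words grow by prepending a letter, so left multiplication by the two generators
  suffices. This fits left actions and sets stable under left multiplication.\<close>

lemma free_alg_induct [case_names one scale add up down]:
  fixes x :: "'k::field_char_0 free_alg"
  assumes one: "P 1" and scale: "\<And>c x. P x \<Longrightarrow> P (fconst c * x)"
    and add: "\<And>x y. P x \<Longrightarrow> P y \<Longrightarrow> P (x + y)"
    and up: "\<And>x. P x \<Longrightarrow> P (fu * x)" and down: "\<And>x. P x \<Longrightarrow> P (fd * x)"
  shows "P x"
proof (induction x rule: free_alg_single_induct)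
  case (single w c)
  obtain ls where w: "w = Word ls" by (cases w)
  show ?case unfolding w
  proof (induction ls)
    case Nil
    have "Poly_Mapping.single (Word []) c = fconst c * 1"
      by (simp add: fconst_def zero_word_def)
    then show ?case using scale[OF one] by simp
  next
    case (Cons l ls)
    then show ?case using up down by (cases l) (simp_all add: single_Cons fletter_def)
  qed
qed (rule add)

interpretation free_alg: vector_space "\<lambda>c (x :: 'k::field_char_0 free_alg). fconst c * x"
  by unfold_locales (simp_all add: algebra_simps fconst_add fconst_mult)

declare free_alg.scale_scale [simp del]

text \<open>By freeness any two linear endomorphisms define a representation. The skew Laurent
  module and the monomial model for \<beta> = 0 are its two instances.\<close>

locale free_alg_rep = vector_space scale
  for scale :: "'k::field_char_0 \<Rightarrow> 'm::ab_group_add \<Rightarrow> 'm" +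
  fixes Lu Ld :: "'m \<Rightarrow> 'm"
  assumes Lu_add: "Lu (f + g) = Lu f + Lu g" and Lu_scale: "Lu (scale c f) = scale c (Lu f)"
    and Ld_add: "Ld (f + g) = Ld f + Ld g" and Ld_scale: "Ld (scale c f) = scale c (Ld f)"
begin

fun word_act :: "word \<Rightarrow> 'm \<Rightarrow> 'm" where
  "word_act (Word ls) f = foldr (\<lambda>l. case l of Up \<Rightarrow> Lu | Down \<Rightarrow> Ld) ls f"

definition act :: "'k free_alg \<Rightarrow> 'm \<Rightarrow> 'm" where
  "act x f = (\<Sum>w\<in>Poly_Mapping.keys x. scale (Poly_Mapping.lookup x w) (word_act w f))"

lemma act_superset:
  assumes "finite S" "Poly_Mapping.keys x \<subseteq> S"
  shows "act x f = (\<Sum>w\<in>S. scale (Poly_Mapping.lookup x w) (word_act w f))"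
  unfolding act_def by (rule sum.mono_neutral_left) (use assms in \<open>auto simp: in_keys_iff\<close>)

lemma act_add_left: "act (x + y) f = act x f + act y f"
proof -
  let ?S = "Poly_Mapping.keys x \<union> Poly_Mapping.keys y"
  have "act (x + y) f = (\<Sum>w\<in>?S. scale (Poly_Mapping.lookup (x + y) w) (word_act w f))"
    by (rule act_superset) (use keys_add[of x y] in auto)
  also have "\<dots> = act x f + act y f"
    by (simp add: act_superset[of ?S] lookup_add scale_left_distrib sum.distrib)
  finally show ?thesis .
qed

lemma act_single: "act (Poly_Mapping.single w c) f = scale c (word_act w f)"
  by (simp add: act_superset[of "{w}"])

lemma act_zero_left [simp]: "act 0 f = 0"
  by (simp add: act_def)

lemma act_scale_left: "act (fconst c * x) f = scale c (act x f)"
  by (induction x rule: free_alg_single_induct)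
     (simp_all add: fconst_mult_single act_single act_add_left ring_distribs scale_right_distrib)

lemma act_letter: "act (fletter l * x) f = (case l of Up \<Rightarrow> Lu | Down \<Rightarrow> Ld) (act x f)"
proof (induction x rule: free_alg_single_induct)
  case (single w c)
  then show ?case
    by (cases w; cases l) (simp_all add: single_Cons[symmetric] act_single Lu_scale Ld_scale)
next
  case (add x y)
  then show ?case by (cases l) (simp_all add: ring_distribs act_add_left Lu_add Ld_add)
qed

lemma act_fu_left [simp]: "act (fu * x) f = Lu (act x f)"
  and act_fd_left [simp]: "act (fd * x) f = Ld (act x f)"
  using act_letter[of Up] act_letter[of Down] by (simp_all add: fletter_def)

lemma act_one [simp]: "act 1 f = f"
proof -
  have "word_act 0 f = f" by (simp add: zero_word_def)
  then show ?thesis using act_single[of 0 1 f] by simp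
qed

lemma act_fconst [simp]: "act (fconst c) f = scale c f"
  using act_scale_left[of c 1 f] by simp

lemma act_fu [simp]: "act fu f = Lu f" and act_fd [simp]: "act fd f = Ld f"
  using act_fu_left[of 1] act_fd_left[of 1] by simp_all

lemma act_mult: "act (x * y) f = act x (act y f)"
  by (induction x rule: free_alg_induct)
     (simp_all add: act_add_left act_scale_left ring_distribs mult.assoc)

lemma act_uminus_left: "act (- x) f = - act x f"
  using act_add_left[of x "- x" f] by (simp add: eq_neg_iff_add_eq_0 add.commute)

lemma act_diff_left: "act (x - y) f = act x f - act y f"
  using act_add_left[of x "- y" f] by (simp add: act_uminus_left)

lemma act_sum_left: "act (sum h T) f = (\<Sum>t\<in>T. act (h t) f)"
  by (induction T rule: infinite_finite_induct) (simp_all add: act_add_left)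

text \<open>Meant for right multiplications: \<open>R\<close> commutes with the generators, hence
  with the whole left action.\<close>

lemma act_commute:
  assumes "\<And>f g. R (f + g) = R f + R g" and "\<And>c f. R (scale c f) = scale c (R f)"
    and "\<And>f. R (Lu f) = Lu (R f)" and "\<And>f. R (Ld f) = Ld (R f)"
  shows "act x (R f) = R (act x f)"
  by (induction x rule: free_alg_induct) (simp_all add: assms act_add_left act_scale_left)

lemma act_zero_right [simp]: "act x 0 = 0"
  by (induction x rule: free_alg_induct)
     (use Lu_scale[of 0 0] Ld_scale[of 0 0] in \<open>simp_all add: act_add_left act_scale_left\<close>)

lemma act_power: "act (x ^ n) f = (act x ^^ n) f"
  by (induction n arbitrary: f) (simp_all add: act_mult)

end

section \<open>The relation ideal and the quotient\<close>

lemma ideal_du_ideal: "ideal (du_ideal \<alpha> \<beta>) class_ring"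
  unfolding du_ideal_def
  by (rule ring.genideal_ideal[OF class_ring.ring_axioms]) simp

lemma du_ideal_minimal:
  assumes "ideal J class_ring" "du_relators \<alpha> \<beta> \<subseteq> J"
  shows "du_ideal \<alpha> \<beta> \<subseteq> J"
  unfolding du_ideal_def using assms by (auto simp: genideal_def)

lemma du_relators_in_ideal: "x \<in> du_relators \<alpha> \<beta> \<Longrightarrow> x \<in> du_ideal \<alpha> \<beta>"
  unfolding du_ideal_def by (auto simp: genideal_def)

lemma
  shows du_ideal_zero [simp]: "0 \<in> du_ideal \<alpha> \<beta>"
    and du_ideal_add: "x \<in> du_ideal \<alpha> \<beta> \<Longrightarrow> y \<in> du_ideal \<alpha> \<beta> \<Longrightarrow> x + y \<in> du_ideal \<alpha> \<beta>"
    and du_ideal_lmult: "x \<in> du_ideal \<alpha> \<beta> \<Longrightarrow> z * x \<in> du_ideal \<alpha> \<beta>"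
    and du_ideal_rmult: "x \<in> du_ideal \<alpha> \<beta> \<Longrightarrow> x * z \<in> du_ideal \<alpha> \<beta>"
proof -
  interpret ideal "du_ideal \<alpha> \<beta>" class_ring by (rule ideal_du_ideal)
  show "0 \<in> du_ideal \<alpha> \<beta>"
    using additive_subgroup.zero_closed[OF is_additive_subgroup] by simp
  show "x \<in> du_ideal \<alpha> \<beta> \<Longrightarrow> y \<in> du_ideal \<alpha> \<beta> \<Longrightarrow> x + y \<in> du_ideal \<alpha> \<beta>"
    using a_closed by simp
  show "x \<in> du_ideal \<alpha> \<beta> \<Longrightarrow> z * x \<in> du_ideal \<alpha> \<beta>"
    using I_l_closed[of x z] by simp
  show "x \<in> du_ideal \<alpha> \<beta> \<Longrightarrow> x * z \<in> du_ideal \<alpha> \<beta>"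
    using I_r_closed[of x z] by simp
qed

lemma du_ideal_uminus: "x \<in> du_ideal \<alpha> \<beta> \<Longrightarrow> - x \<in> du_ideal \<alpha> \<beta>"
  using du_ideal_lmult[of x \<alpha> \<beta> "- 1"] by simp

lemma du_ideal_diff: "x \<in> du_ideal \<alpha> \<beta> \<Longrightarrow> y \<in> du_ideal \<alpha> \<beta> \<Longrightarrow> x - y \<in> du_ideal \<alpha> \<beta>"
  using du_ideal_add[of x \<alpha> \<beta> "- y"] du_ideal_uminus[of y \<alpha> \<beta>] by simp

lemma span_mod_ideal:
  assumes "x \<in> free_alg.span (du_ideal \<alpha> \<beta> \<union> Set.range N)"
  shows "\<exists>T c. finite T \<and> x - (\<Sum>t\<in>T. fconst (c t) * N t) \<in> du_ideal \<alpha> \<beta>"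
proof -
  have "free_alg.subspace (du_ideal \<alpha> \<beta>)"
    by (simp add: free_alg.subspace_def du_ideal_add du_ideal_lmult)
  then have span_I: "free_alg.span (du_ideal \<alpha> \<beta>) = du_ideal \<alpha> \<beta>" by simp
  have "x \<in> {y + z | y z. y \<in> du_ideal \<alpha> \<beta> \<and> z \<in> free_alg.span (Set.range N)}"
    using assms unfolding free_alg.span_Un span_I .
  then obtain y z where yz: "x = y + z" "y \<in> du_ideal \<alpha> \<beta>" "z \<in> free_alg.span (Set.range N)"
    by blast
  obtain A r where A: "finite A" "A \<subseteq> Set.range N" "z = (\<Sum>a\<in>A. fconst (r a) * a)"
    using yz(3) by (auto simp: free_alg.span_explicit)
  \<comment> \<open>\<open>N\<close> need not be injective, so an index set is chosen on which it
    is; the sum over vectors then becomes a sum over indices.\<close>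
  obtain T where "inj_on N T" "A = N ` T"
    using A(2) by (auto simp: subset_image_inj)
  then have "finite T" "z = (\<Sum>t\<in>T. fconst (r (N t)) * N t)"
    using A by (auto simp: finite_image_iff sum.reindex)
  then show ?thesis using yz by (intro exI[of _ T] exI[of _ "\<lambda>t. r (N t)"]) simp
qed

text \<open>The elements acting as zero form a two-sided ideal, so by minimality it is enough to
  check the two relations on operators.\<close>

lemma (in free_alg_rep) act_du_ideal:
  assumes "\<And>f. Ld (Ld (Lu f)) = scale \<alpha> (Ld (Lu (Ld f))) + scale \<beta> (Lu (Ld (Ld f)))"
    and "\<And>f. Ld (Lu (Lu f)) = scale \<alpha> (Lu (Ld (Lu f))) + scale \<beta> (Lu (Lu (Ld f)))"
    and "x \<in> du_ideal \<alpha> \<beta>"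
  shows "act x f = 0"
proof -
  have "ideal {x. \<forall>f. act x f = 0} class_ring"
  proof (rule idealI)
    show "Ring.ring (class_ring :: 'k free_alg ring)" by (rule class_ring.ring_axioms)
    have "group (add_monoid (class_ring :: 'k free_alg ring))"
      using class_ring.a_group by simp
    moreover have "m_inv (add_monoid class_ring) x = - x" for x :: "'k free_alg"
      using fun_cong[OF class_ring_simps(8), of x] by (simp add: a_inv_def)
    ultimately show "subgroup {x. \<forall>f. act x f = 0} (add_monoid class_ring)"
      by (intro group.subgroupI)
         (auto simp: act_add_left act_uminus_left intro!: exI[of _ 0])
  qed (auto simp: act_mult)
  then have "du_ideal \<alpha> \<beta> \<subseteq> {x. \<forall>f. act x f = 0}"
    by (rule du_ideal_minimal)
       (auto simp: du_relators_def act_diff_left act_add_left act_mult assms)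
  with assms(3) show ?thesis by auto
qed

lemma du_class_eq_iff: "du_class \<alpha> \<beta> x = du_class \<alpha> \<beta> y \<longleftrightarrow> x - y \<in> du_ideal \<alpha> \<beta>"
proof -
  have mem: "z \<in> du_class \<alpha> \<beta> x \<longleftrightarrow> z - x \<in> du_ideal \<alpha> \<beta>" for z x
    by (auto simp: du_class_def a_r_coset_def r_coset_def) (metis diff_add_cancel)
  show ?thesis
  proof
    assume "du_class \<alpha> \<beta> x = du_class \<alpha> \<beta> y"
    then show "x - y \<in> du_ideal \<alpha> \<beta>" using mem[of x x] mem[of x y] by simp
  next
    assume xy: "x - y \<in> du_ideal \<alpha> \<beta>"
    have "z - x \<in> du_ideal \<alpha> \<beta> \<longleftrightarrow> z - y \<in> du_ideal \<alpha> \<beta>" for z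
      using du_ideal_add[OF _ xy, of "z - x"] du_ideal_diff[OF _ xy, of "z - y"] by auto
    then show "du_class \<alpha> \<beta> x = du_class \<alpha> \<beta> y" by (auto simp: mem)
  qed
qed

text \<open>With these rules all later work takes place on representatives in the free algebra,
  modulo \<open>du_ideal\<close>.\<close>

lemma
  fixes \<alpha> \<beta> :: "'k::field_char_0"
  defines "A \<equiv> down_up_algebra \<alpha> \<beta>"
  shows carrier_down_up_algebra: "carrier A = range (du_class \<alpha> \<beta>)"
    and down_up_mult: "du_class \<alpha> \<beta> x \<otimes>\<^bsub>A\<^esub> du_class \<alpha> \<beta> y = du_class \<alpha> \<beta> (x * y)"
    and down_up_add: "du_class \<alpha> \<beta> x \<oplus>\<^bsub>A\<^esub> du_class \<alpha> \<beta> y = du_class \<alpha> \<beta> (x + y)"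
    and down_up_smult: "c \<odot>\<^bsub>A\<^esub> du_class \<alpha> \<beta> x = du_class \<alpha> \<beta> (fconst c * x)"
    and down_up_zero: "\<zero>\<^bsub>A\<^esub> = du_class \<alpha> \<beta> 0"
    and down_up_uminus: "\<ominus>\<^bsub>A\<^esub> du_class \<alpha> \<beta> x = du_class \<alpha> \<beta> (- x)"
    and down_up_pow: "du_class \<alpha> \<beta> x [^]\<^bsub>A\<^esub> (n :: nat) = du_class \<alpha> \<beta> (x ^ n)"
proof -
  interpret ideal "du_ideal \<alpha> \<beta>" class_ring by (rule ideal_du_ideal)
  let ?Q = "class_ring Quot du_ideal \<alpha> \<beta>"
  interpret Q: Ring.ring ?Q by (rule quotient_is_ring)
  have A: "carrier A = carrier ?Q" "mult A = mult ?Q" "one A = one ?Q" "zero A = zero ?Q"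
    "add A = add ?Q" "smult A = (\<lambda>c x. du_class \<alpha> \<beta> (fconst c) \<otimes>\<^bsub>?Q\<^esub> x)"
    by (simp_all add: A_def down_up_algebra_def Let_def)
  show car: "carrier A = range (du_class \<alpha> \<beta>)"
    by (auto simp: A FactRing_def A_RCOSETS_defs du_class_def a_r_coset_def)
  show m: "du_class \<alpha> \<beta> x \<otimes>\<^bsub>A\<^esub> du_class \<alpha> \<beta> y = du_class \<alpha> \<beta> (x * y)" for x y
    using rcoset_mult_add[of x y] by (simp add: A(2) FactRing_def du_class_def)
  show a: "du_class \<alpha> \<beta> x \<oplus>\<^bsub>A\<^esub> du_class \<alpha> \<beta> y = du_class \<alpha> \<beta> (x + y)" for x y
    using a_rcos_sum[of x y] by (simp add: A(5) FactRing_def du_class_def)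
  show "c \<odot>\<^bsub>A\<^esub> du_class \<alpha> \<beta> x = du_class \<alpha> \<beta> (fconst c * x)"
    using m[of "fconst c" x] by (simp add: A)
  show z: "\<zero>\<^bsub>A\<^esub> = du_class \<alpha> \<beta> 0"
    by (auto simp: A FactRing_def du_class_def a_r_coset_def r_coset_def)
  have o: "\<one>\<^bsub>A\<^esub> = du_class \<alpha> \<beta> 1"
    by (simp add: A FactRing_def du_class_def)
  show "\<ominus>\<^bsub>A\<^esub> du_class \<alpha> \<beta> x = du_class \<alpha> \<beta> (- x)"
  proof -
    have "\<ominus>\<^bsub>?Q\<^esub> du_class \<alpha> \<beta> x = du_class \<alpha> \<beta> (- x)"
      using Q.minus_equality[of "du_class \<alpha> \<beta> (- x)" "du_class \<alpha> \<beta> x"] a[of "- x" x] car z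
      by (auto simp: A)
    then show ?thesis by (simp add: a_inv_def m_inv_def A)
  qed
  show "du_class \<alpha> \<beta> x [^]\<^bsub>A\<^esub> n = du_class \<alpha> \<beta> (x ^ n)" for n :: nat
    by (induction n) (simp_all add: nat_pow_def o m power_commutes)
qed

definition lin_w :: "'k \<Rightarrow> 'k \<Rightarrow> 'k::field_char_0 free_alg" where
  "lin_w \<beta> r = fconst \<beta> * (fu * fd) + fconst r * (fd * fu)"

lemma du_w_eq: "du_w \<alpha> \<beta> r = du_class \<alpha> \<beta> (lin_w \<beta> r)"
  by (simp add: du_w_def Let_def du_u_def du_d_def lin_w_def down_up_mult down_up_smult down_up_add)

section \<open>Cycles of degree three\<close>

text \<open>These are the two components of \<open>diff3\<close> on a representative; the sign of
  the first is dropped because an ideal is closed under negation.\<close>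

definition cycle3 :: "'k \<Rightarrow> 'k \<Rightarrow> 'k::field_char_0 free_alg \<Rightarrow> bool" where
  "cycle3 \<alpha> \<beta> x \<longleftrightarrow> fu * x + fconst \<beta> * (x * fu) \<in> du_ideal \<alpha> \<beta> \<and>
    x * fd + fconst \<beta> * (fd * x) \<in> du_ideal \<alpha> \<beta>"

definition free_tensor ::
    "'k \<Rightarrow> 'k \<Rightarrow> 'k::field_char_0 free_alg \<Rightarrow> word \<Rightarrow> 'k free_alg set" where
  "free_tensor \<alpha> \<beta> x = Omega_tensor \<alpha> \<beta> (du_class \<alpha> \<beta> x)"

lemma free_tensor_eq_iff:
  "free_tensor \<alpha> \<beta> x = free_tensor \<alpha> \<beta> y \<longleftrightarrow> x - y \<in> du_ideal \<alpha> \<beta>"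
proof
  assume "free_tensor \<alpha> \<beta> x = free_tensor \<alpha> \<beta> y"
  then have "free_tensor \<alpha> \<beta> x dduu = free_tensor \<alpha> \<beta> y dduu" by simp
  then show "x - y \<in> du_ideal \<alpha> \<beta>"
    by (simp add: free_tensor_def Omega_tensor_def pure_tensor_def du_class_eq_iff)
next
  assume "x - y \<in> du_ideal \<alpha> \<beta>"
  then have "du_class \<alpha> \<beta> x = du_class \<alpha> \<beta> y" by (simp only: du_class_eq_iff)
  then show "free_tensor \<alpha> \<beta> x = free_tensor \<alpha> \<beta> y" by (simp add: free_tensor_def)
qed

lemma
  shows HH3_add: "free_tensor \<alpha> \<beta> x \<oplus>\<^bsub>HH3 \<alpha> \<beta>\<^esub> free_tensor \<alpha> \<beta> y = free_tensor \<alpha> \<beta> (x + y)"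
    and HH3_smult: "c \<odot>\<^bsub>HH3 \<alpha> \<beta>\<^esub> free_tensor \<alpha> \<beta> x = free_tensor \<alpha> \<beta> (fconst c * x)"
    and HH3_zero: "\<zero>\<^bsub>HH3 \<alpha> \<beta>\<^esub> = free_tensor \<alpha> \<beta> 0"
  by (auto simp: HH3_def A_Omega_def tensor_words_def free_tensor_def Omega_tensor_def
      pure_tensor_def down_up_add down_up_smult down_up_zero fun_eq_iff)

lemma ddu_neq_duu: "ddu \<noteq> duu" "duu \<noteq> ddu"
  by (simp_all add: ddu_def duu_def)

lemma carrier_HH3: "carrier (HH3 \<alpha> \<beta>) = {free_tensor \<alpha> \<beta> x | x. cycle3 \<alpha> \<beta> x}"
proof -
  have om: "carrier (A_Omega \<alpha> \<beta>) = range (free_tensor \<alpha> \<beta>)"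
  proof
    show "carrier (A_Omega \<alpha> \<beta>) \<subseteq> range (free_tensor \<alpha> \<beta>)"
    proof
      fix f assume f: "f \<in> carrier (A_Omega \<alpha> \<beta>)"
      then obtain x where "f dduu = du_class \<alpha> \<beta> x"
        by (auto simp: A_Omega_def tensor_words_def carrier_down_up_algebra)
      then have "f = free_tensor \<alpha> \<beta> x"
        using f by (auto simp: A_Omega_def tensor_words_def free_tensor_def Omega_tensor_def
            pure_tensor_def fun_eq_iff)
      then show "f \<in> range (free_tensor \<alpha> \<beta>)" by simp
    qed
  qed (auto simp: A_Omega_def tensor_words_def free_tensor_def Omega_tensor_def pure_tensor_def
      carrier_down_up_algebra)
  have "diff3 \<alpha> \<beta> (free_tensor \<alpha> \<beta> x) = \<zero>\<^bsub>A_R \<alpha> \<beta>\<^esub> \<longleftrightarrow> cycle3 \<alpha> \<beta> x" for x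
  proof -
    let ?p = "du_class \<alpha> \<beta> (- (fu * x + fconst \<beta> * (x * fu)))"
    let ?q = "du_class \<alpha> \<beta> (x * fd + fconst \<beta> * (fd * x))"
    let ?D = "diff3 \<alpha> \<beta> (free_tensor \<alpha> \<beta> x)"
    have D: "?D = (\<lambda>y. if y = ddu then ?p else if y = duu then ?q else du_class \<alpha> \<beta> 0)"
      using ddu_neq_duu
      by (auto simp: fun_eq_iff diff3_def Let_def free_tensor_def Omega_tensor_def pure_tensor_def
          A_R_def tensor_words_def du_u_def du_d_def down_up_mult down_up_add down_up_smult
          down_up_uminus down_up_zero)
    have "?D = \<zero>\<^bsub>A_R \<alpha> \<beta>\<^esub> \<longleftrightarrow> ?p = du_class \<alpha> \<beta> 0 \<and> ?q = du_class \<alpha> \<beta> 0"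
      unfolding D using ddu_neq_duu
      by (auto simp: A_R_def tensor_words_def down_up_zero fun_eq_iff)
    also have "\<dots> \<longleftrightarrow> cycle3 \<alpha> \<beta> x"
      using du_ideal_uminus[of "fu * x + fconst \<beta> * (x * fu)" \<alpha> \<beta>]
        du_ideal_uminus[of "- (fu * x + fconst \<beta> * (x * fu))" \<alpha> \<beta>]
      by (auto simp: du_class_eq_iff cycle3_def add.commute)
    finally show ?thesis .
  qed
  then show ?thesis by (auto simp: HH3_def om)
qed

lemma
  shows cycle3_zero: "cycle3 \<alpha> \<beta> 0"
    and cycle3_add: "cycle3 \<alpha> \<beta> x \<Longrightarrow> cycle3 \<alpha> \<beta> y \<Longrightarrow> cycle3 \<alpha> \<beta> (x + y)"
    and cycle3_scale: "cycle3 \<alpha> \<beta> x \<Longrightarrow> cycle3 \<alpha> \<beta> (fconst c * x)"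
proof -
  show "cycle3 \<alpha> \<beta> 0" by (simp add: cycle3_def)
  have "fu * (x + y) + fconst \<beta> * ((x + y) * fu)
      = (fu * x + fconst \<beta> * (x * fu)) + (fu * y + fconst \<beta> * (y * fu))"
    "(x + y) * fd + fconst \<beta> * (fd * (x + y))
      = (x * fd + fconst \<beta> * (fd * x)) + (y * fd + fconst \<beta> * (fd * y))"
    by (simp_all add: algebra_simps)
  then show "cycle3 \<alpha> \<beta> x \<Longrightarrow> cycle3 \<alpha> \<beta> y \<Longrightarrow> cycle3 \<alpha> \<beta> (x + y)"
    unfolding cycle3_def by (simp add: du_ideal_add)
  have "fu * (fconst c * x) + fconst \<beta> * (fconst c * x * fu)
      = fconst c * (fu * x + fconst \<beta> * (x * fu))"
    "fconst c * x * fd + fconst \<beta> * (fd * (fconst c * x))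
      = fconst c * (x * fd + fconst \<beta> * (fd * x))"
    by (simp_all add: distrib_left mult.assoc fconst_left_commute[of fu]
        fconst_left_commute[of fd] fconst_left_commute[of "fconst \<beta>"])
  then show "cycle3 \<alpha> \<beta> x \<Longrightarrow> cycle3 \<alpha> \<beta> (fconst c * x)"
    unfolding cycle3_def by (simp add: du_ideal_lmult)
qed

lemma free_tensor_in_HH3: "cycle3 \<alpha> \<beta> x \<Longrightarrow> free_tensor \<alpha> \<beta> x \<in> carrier (HH3 \<alpha> \<beta>)"
  by (auto simp: carrier_HH3)

lemma HH3_E:
  assumes "v \<in> carrier (HH3 \<alpha> \<beta>)"
  obtains x where "v = free_tensor \<alpha> \<beta> x" "cycle3 \<alpha> \<beta> x"
  using assms by (auto simp: carrier_HH3)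

lemma vectorspace_HH3: "vectorspace class_ring (HH3 \<alpha> \<beta>)"
proof -
  note closed = free_tensor_in_HH3 cycle3_zero cycle3_add cycle3_scale
  note ops = HH3_add HH3_smult HH3_zero
  let ?H = "carrier (HH3 \<alpha> \<beta>)"
  have "Module.module class_ring (HH3 \<alpha> \<beta>)"
  proof (rule module_criteria)
    show "cring (class_ring :: 'a ring)" by (rule class_cring.cring_axioms)
  next
    show "\<zero>\<^bsub>HH3 \<alpha> \<beta>\<^esub> \<in> carrier (HH3 \<alpha> \<beta>)" by (simp add: ops closed)
  next
    show "\<forall>v\<in>carrier (HH3 \<alpha> \<beta>). \<exists>neg_v\<in>carrier (HH3 \<alpha> \<beta>).
        v \<oplus>\<^bsub>HH3 \<alpha> \<beta>\<^esub> neg_v = \<zero>\<^bsub>HH3 \<alpha> \<beta>\<^esub>"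
    proof
      fix v assume "v \<in> carrier (HH3 \<alpha> \<beta>)"
      then obtain x where x: "v = free_tensor \<alpha> \<beta> x" "cycle3 \<alpha> \<beta> x" by (rule HH3_E)
      then have "cycle3 \<alpha> \<beta> (- x)" using cycle3_scale[of \<alpha> \<beta> x "- 1"] by (simp add: fconst_uminus)
      then show "\<exists>neg_v\<in>carrier (HH3 \<alpha> \<beta>). v \<oplus>\<^bsub>HH3 \<alpha> \<beta>\<^esub> neg_v = \<zero>\<^bsub>HH3 \<alpha> \<beta>\<^esub>"
        using x by (intro bexI[of _ "free_tensor \<alpha> \<beta> (- x)"]) (simp_all add: ops closed)
    qed
  next
    show "\<forall>v w. v \<in> ?H \<and> w \<in> ?H \<longrightarrow> v \<oplus>\<^bsub>HH3 \<alpha> \<beta>\<^esub> w \<in> ?H"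
      "\<forall>v w. v \<in> ?H \<and> w \<in> ?H \<longrightarrow> v \<oplus>\<^bsub>HH3 \<alpha> \<beta>\<^esub> w = w \<oplus>\<^bsub>HH3 \<alpha> \<beta>\<^esub> v"
      "\<forall>v w x. v \<in> ?H \<and> w \<in> ?H \<and> x \<in> ?H \<longrightarrow>
        v \<oplus>\<^bsub>HH3 \<alpha> \<beta>\<^esub> w \<oplus>\<^bsub>HH3 \<alpha> \<beta>\<^esub> x = v \<oplus>\<^bsub>HH3 \<alpha> \<beta>\<^esub> (w \<oplus>\<^bsub>HH3 \<alpha> \<beta>\<^esub> x)"
      "\<forall>v\<in>?H. v \<oplus>\<^bsub>HH3 \<alpha> \<beta>\<^esub> \<zero>\<^bsub>HH3 \<alpha> \<beta>\<^esub> = v"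
      by (auto simp: ops closed ac_simps elim!: HH3_E)
    show "\<forall>c v. c \<in> carrier class_ring \<and> v \<in> ?H \<longrightarrow> c \<odot>\<^bsub>HH3 \<alpha> \<beta>\<^esub> v \<in> ?H"
      "\<forall>v\<in>?H. \<one>\<^bsub>class_ring\<^esub> \<odot>\<^bsub>HH3 \<alpha> \<beta>\<^esub> v = v"
      by (auto simp: ops closed elim!: HH3_E)
    show "\<forall>a b v. a \<in> carrier class_ring \<and> b \<in> carrier class_ring \<and> v \<in> ?H \<longrightarrow>
        (a \<otimes>\<^bsub>class_ring\<^esub> b) \<odot>\<^bsub>HH3 \<alpha> \<beta>\<^esub> v = a \<odot>\<^bsub>HH3 \<alpha> \<beta>\<^esub> (b \<odot>\<^bsub>HH3 \<alpha> \<beta>\<^esub> v)"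
      by (auto simp: ops fconst_mult mult.assoc elim!: HH3_E)
    show "\<forall>a b v. a \<in> carrier class_ring \<and> b \<in> carrier class_ring \<and> v \<in> ?H \<longrightarrow>
        (a \<oplus>\<^bsub>class_ring\<^esub> b) \<odot>\<^bsub>HH3 \<alpha> \<beta>\<^esub> v
          = a \<odot>\<^bsub>HH3 \<alpha> \<beta>\<^esub> v \<oplus>\<^bsub>HH3 \<alpha> \<beta>\<^esub> b \<odot>\<^bsub>HH3 \<alpha> \<beta>\<^esub> v"
      by (auto simp: ops fconst_add distrib_right elim!: HH3_E)
    show "\<forall>a v w. a \<in> carrier class_ring \<and> v \<in> ?H \<and> w \<in> ?H \<longrightarrow>
        a \<odot>\<^bsub>HH3 \<alpha> \<beta>\<^esub> (v \<oplus>\<^bsub>HH3 \<alpha> \<beta>\<^esub> w)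
          = a \<odot>\<^bsub>HH3 \<alpha> \<beta>\<^esub> v \<oplus>\<^bsub>HH3 \<alpha> \<beta>\<^esub> a \<odot>\<^bsub>HH3 \<alpha> \<beta>\<^esub> w"
      by (auto simp: ops distrib_left elim!: HH3_E)
  qed
  moreover have "Ring.field (class_ring :: 'a ring)" by (rule class_field.field_axioms)
  ultimately show ?thesis by (simp add: vectorspace_def)
qed

lemma HH3_finsum:
  assumes "finite T" "\<And>t. t \<in> T \<Longrightarrow> cycle3 \<alpha> \<beta> (h t)"
  shows "(\<Oplus>\<^bsub>HH3 \<alpha> \<beta>\<^esub>t\<in>T. free_tensor \<alpha> \<beta> (h t)) = free_tensor \<alpha> \<beta> (sum h T)"
proof -
  interpret vectorspace class_ring "HH3 \<alpha> \<beta>" by (rule vectorspace_HH3)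
  from assms show ?thesis
  proof (induction T rule: finite_induct)
    case empty
    then show ?case by (simp add: HH3_zero)
  next
    case (insert t T)
    then show ?case
      by (subst M.finsum_insert) (auto simp: free_tensor_in_HH3 HH3_add)
  qed
qed

text \<open>Both \<open>indep\<close> and \<open>span\<close> concern indexed families in the free
  algebra modulo the ideal, so that linear combinations inside \<open>HH3\<close> are handled here
  once and for all.\<close>

lemma HH3_basisI:
  fixes b :: "'j \<Rightarrow> 'k::field_char_0 free_alg"
  assumes cycle: "\<And>t. t \<in> J \<Longrightarrow> cycle3 \<alpha> \<beta> (b t)"
    and indep: "\<And>T c. finite T \<Longrightarrow> T \<subseteq> J \<Longrightarrow> (\<Sum>t\<in>T. fconst (c t) * b t) \<in> du_ideal \<alpha> \<beta>
      \<Longrightarrow> \<forall>t\<in>T. c t = 0"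
    and span: "\<And>x. cycle3 \<alpha> \<beta> x \<Longrightarrow>
      \<exists>T c. finite T \<and> T \<subseteq> J \<and> x - (\<Sum>t\<in>T. fconst (c t) * b t) \<in> du_ideal \<alpha> \<beta>"
  shows "vectorspace.basis class_ring (HH3 \<alpha> \<beta>) ((\<lambda>t. free_tensor \<alpha> \<beta> (b t)) ` J)"
proof -
  interpret vectorspace class_ring "HH3 \<alpha> \<beta>" by (rule vectorspace_HH3)
  let ?b = "\<lambda>t. free_tensor \<alpha> \<beta> (b t)"
  have inj: "inj_on ?b J"
  proof (rule inj_onI, rule ccontr)
    fix s t assume st: "s \<in> J" "t \<in> J" "?b s = ?b t" "s \<noteq> t"
    \<comment> \<open>Two indices with the same class would satisfy a relation with coefficients 1
      and -1, so independence of the family already contains injectivity.\<close>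
    let ?c = "\<lambda>r. if r = s then 1 else - 1 :: 'k"
    have "(\<Sum>r\<in>{s, t}. fconst (?c r) * b r) \<in> du_ideal \<alpha> \<beta>"
      using st by (auto simp: free_tensor_eq_iff fconst_uminus)
    from indep[OF _ _ this] st show False by auto
  qed
  have comb: "lincomb a (?b ` T) = free_tensor \<alpha> \<beta> (\<Sum>t\<in>T. fconst (a (?b t)) * b t)"
    if "finite T" "T \<subseteq> J" for a T
  proof -
    have "lincomb a (?b ` T) = (\<Oplus>\<^bsub>HH3 \<alpha> \<beta>\<^esub>t\<in>T. a (?b t) \<odot>\<^bsub>HH3 \<alpha> \<beta>\<^esub> ?b t)"
      unfolding lincomb_def using that inj cycle
      by (intro M.finsum_reindex) (auto simp: HH3_smult subset_iff free_tensor_in_HH3 cycle3_scale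
          intro: inj_on_subset)
    also have "\<dots> = (\<Oplus>\<^bsub>HH3 \<alpha> \<beta>\<^esub>t\<in>T. free_tensor \<alpha> \<beta> (fconst (a (?b t)) * b t))"
      by (simp add: HH3_smult)
    also have "\<dots> = free_tensor \<alpha> \<beta> (\<Sum>t\<in>T. fconst (a (?b t)) * b t)"
      using that cycle by (intro HH3_finsum) (auto intro!: cycle3_scale)
    finally show ?thesis .
  qed
  have car: "?b ` J \<subseteq> carrier (HH3 \<alpha> \<beta>)"
    using cycle by (auto simp: carrier_HH3)
  have "lin_indpt (?b ` J)"
  proof
    assume "lin_dep (?b ` J)"
    then obtain A a v where A: "finite A" "A \<subseteq> ?b ` J" "lincomb a A = \<zero>\<^bsub>HH3 \<alpha> \<beta>\<^esub>"
      "v \<in> A" "a v \<noteq> 0"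
      by (auto simp: lin_dep_def)
    then obtain T where T: "T \<subseteq> J" "finite T" "A = ?b ` T"
      by (meson finite_subset_image)
    have "(\<Sum>t\<in>T. fconst (a (?b t)) * b t) \<in> du_ideal \<alpha> \<beta>"
      using A(3) comb[OF T(2,1), of a] T(3)
        free_tensor_eq_iff[of \<alpha> \<beta> "\<Sum>t\<in>T. fconst (a (?b t)) * b t" 0] by (simp add: HH3_zero)
    from indep[OF T(2,1) this] A T show False by auto
  qed
  moreover have "gen_set (?b ` J)"
  proof -
    have "v \<in> span (?b ` J)" if v: "v \<in> carrier (HH3 \<alpha> \<beta>)" for v
    proof -
      from v obtain x where x: "v = free_tensor \<alpha> \<beta> x" "cycle3 \<alpha> \<beta> x" by (auto simp: carrier_HH3)
      from span[OF x(2)] obtain T c where T: "finite T" "T \<subseteq> J"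
        "x - (\<Sum>t\<in>T. fconst (c t) * b t) \<in> du_ideal \<alpha> \<beta>" by blast
      \<comment> \<open>Coefficients indexed by \<open>J\<close> become coefficients indexed by
        vectors through the inverse of the injection.\<close>
      define a where "a = (\<lambda>v. c (the_inv_into J ?b v))"
      have "a (?b t) = c t" if "t \<in> T" for t
        using that T(2) by (auto simp: a_def the_inv_into_f_f[OF inj])
      then have "lincomb a (?b ` T) = free_tensor \<alpha> \<beta> (\<Sum>t\<in>T. fconst (c t) * b t)"
        by (simp add: comb[OF T(1,2)])
      also have "\<dots> = v" using T(3) x(1) free_tensor_eq_iff by metis
      finally show ?thesis unfolding span_def using T by (auto intro!: exI[of _ a] exI[of _ "?b ` T"])
    qed
    moreover have "span (?b ` J) \<subseteq> carrier (HH3 \<alpha> \<beta>)" using car span_is_subset2 by blast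
    ultimately show ?thesis by blast
  qed
  ultimately show ?thesis using car by (simp add: basis_def)
qed

section \<open>Linear substitutions\<close>

text \<open>The inner variable is w and the outer one x; the substitution is w to \<rho> w and x to
  \<nu> x + \<mu> w, triangular so that it covers a Jordan block as well.\<close>

definition lsub :: "'k \<Rightarrow> 'k \<Rightarrow> 'k \<Rightarrow> 'k::field_char_0 poly poly \<Rightarrow> 'k poly poly" where
  "lsub \<rho> \<nu> \<mu> P = pcompose (map_poly (\<lambda>p. pcompose p [:0, \<rho>:]) P) [:[:0, \<mu>:], [:\<nu>:]:]"

abbreviation pw :: "'k::field_char_0 poly poly" where "pw \<equiv> [:[:0, 1:]:]"
abbreviation px :: "'k::field_char_0 poly poly" where "px \<equiv> [:0, 1:]"

lemma map_poly_add_hom: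
  assumes "f 0 = 0" "\<And>a b. f (a + b) = f a + f b"
  shows "map_poly f (p + q) = map_poly f p + map_poly f q"
  by (rule poly_eqI) (simp add: coeff_map_poly assms)

lemma map_poly_mult_hom:
  fixes f :: "'a::comm_semiring_0 \<Rightarrow> 'b::comm_semiring_0"
  assumes "f 0 = 0" "\<And>a b. f (a + b) = f a + f b" "\<And>a b. f (a * b) = f a * f b"
  shows "map_poly f (p * q) = map_poly f p * map_poly f q"
proof (rule poly_eqI)
  fix n
  have "f (sum h A) = (\<Sum>a\<in>A. f (h a))" for h :: "nat \<Rightarrow> 'a" and A
    by (induction A rule: infinite_finite_induct) (simp_all add: assms)
  then show "coeff (map_poly f (p * q)) n = coeff (map_poly f p * map_poly f q) n"
    by (simp add: coeff_map_poly coeff_mult assms)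
qed

lemma lsub_add: "lsub \<rho> \<nu> \<mu> (P + Q) = lsub \<rho> \<nu> \<mu> P + lsub \<rho> \<nu> \<mu> Q"
  by (simp add: lsub_def map_poly_add_hom pcompose_add)

lemma lsub_mult: "lsub \<rho> \<nu> \<mu> (P * Q) = lsub \<rho> \<nu> \<mu> P * lsub \<rho> \<nu> \<mu> Q"
  by (simp add: lsub_def map_poly_mult_hom pcompose_add pcompose_mult)

lemma lsub_coeff_const [simp]: "lsub \<rho> \<nu> \<mu> [:p:] = [:pcompose p [:0, \<rho>:]:]"
  by (simp add: lsub_def map_poly_pCons)

lemma lsub_0 [simp]: "lsub \<rho> \<nu> \<mu> 0 = 0"
  by (simp add: lsub_def)

lemma lsub_1 [simp]: "lsub \<rho> \<nu> \<mu> 1 = 1"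
  by (simp add: lsub_def map_poly_pCons pCons_one[symmetric] pcompose_1)

lemma lsub_pCons: "lsub \<rho> \<nu> \<mu> (pCons p P) =
    [:pcompose p [:0, \<rho>:]:] + [:[:0, \<mu>:], [:\<nu>:]:] * lsub \<rho> \<nu> \<mu> P"
  by (simp add: lsub_def map_poly_pCons pcompose_pCons)

lemma lsub_smult: "lsub \<rho> \<nu> \<mu> (Polynomial.smult [:c:] P) = Polynomial.smult [:c:] (lsub \<rho> \<nu> \<mu> P)"
  using lsub_mult[of \<rho> \<nu> \<mu> "[:[:c:]:]" P] by simp

text \<open>The third parameter comes from x going to \<nu>' x + \<mu>' w and then to \<nu>' (\<nu>
  x + \<mu> w) + \<mu>' \<rho> w.\<close>

lemma lsub_compose:
  "lsub \<rho> \<nu> \<mu> (lsub \<rho>' \<nu>' \<mu>' P) = lsub (\<rho> * \<rho>') (\<nu> * \<nu>') (\<nu>' * \<mu> + \<mu>' * \<rho>) P"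
proof (induction P)
  case (pCons p P)
  have "pcompose (pcompose p [:0, \<rho>':]) [:0, \<rho>:] = pcompose p [:0, \<rho> * \<rho>':]"
    by (simp add: pcompose_assoc[symmetric] pcompose_pCons mult.commute)
  moreover have "lsub \<rho> \<nu> \<mu> [:[:0, \<mu>':], [:\<nu>':]:] = [:[:0, \<nu>' * \<mu> + \<mu>' * \<rho>:], [:\<nu> * \<nu>':]:]"
    by (simp add: lsub_pCons pcompose_pCons algebra_simps)
  ultimately show ?case
    by (simp only: lsub_pCons lsub_add lsub_mult pCons.IH lsub_0 mult_zero_right add_0_right)
qed simp

lemma lsub_id: "lsub 1 1 0 P = P"
proof (induction P)
  case (pCons p P)
  have "[:[:0, 0:], [:1:]:] = [:0, 1 :: 'a poly:]" by (simp add: pCons_one)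
  then show ?case by (simp only: lsub_pCons pCons.IH pcompose_idR) simp
qed simp

text \<open>The summand \<mu> w only feeds lower powers of x, so the leading coefficient in x does
  not see it.\<close>

lemma lead_coeff_lsub:
  assumes "\<nu> \<noteq> 0" "\<rho> \<noteq> 0"
  shows "coeff (lsub \<rho> \<nu> \<mu> P) (degree P) =
    Polynomial.smult (\<nu> ^ degree P) (pcompose (lead_coeff P) [:0, \<rho>:])"
proof -
  let ?M = "map_poly (\<lambda>p. pcompose p [:0, \<rho>:]) P"
  have "degree ?M = degree P"
    using assms by (intro degree_map_poly) (auto simp: pcompose_eq_0_iff)
  moreover have "degree (lsub \<rho> \<nu> \<mu> P) = degree ?M"
    using assms by (simp add: lsub_def degree_pcompose)
  moreover have "lead_coeff (lsub \<rho> \<nu> \<mu> P) = lead_coeff ?M * [:\<nu>:] ^ degree ?M"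
    using assms lead_coeff_comp[of "[:[:0, \<mu>:], [:\<nu>:]:]" ?M] by (simp add: lsub_def)
  ultimately show ?thesis
    by (simp add: coeff_map_poly poly_const_pow mult.commute)
qed

lemma coeff_lsub_diagonal:
  "coeff (coeff (lsub \<rho> \<nu> 0 P) j) i = \<nu> ^ j * \<rho> ^ i * coeff (coeff P j) i"
  by (simp add: lsub_def coeff_pcompose_linear coeff_map_poly poly_const_pow)

text \<open>Compare leading coefficients, first in \<open>x\<close> and then in \<open>w\<close>.\<close>

lemma lsub_eigenvector_zero:
  assumes "\<nu> \<noteq> 0" "\<rho> \<noteq> 0" and eig: "lsub \<rho> \<nu> \<mu> P = Polynomial.smult [:c:] P"
    and c: "\<And>i j. \<nu> ^ j * \<rho> ^ i \<noteq> c"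
  shows "P = 0"
proof (rule ccontr)
  assume "P \<noteq> 0"
  define p where "p = lead_coeff P"
  have "Polynomial.smult (\<nu> ^ degree P) (pcompose p [:0, \<rho>:]) = Polynomial.smult c p"
    using lead_coeff_lsub[OF assms(1,2), of \<mu> P] by (simp add: eig p_def)
  then have "\<nu> ^ degree P * \<rho> ^ degree p * lead_coeff p = c * lead_coeff p"
    by (metis coeff_pcompose_linear coeff_smult mult.assoc)
  moreover have "lead_coeff p \<noteq> 0" using \<open>P \<noteq> 0\<close> by (simp add: p_def)
  ultimately show False using c by simp
qed

lemma smult_const_uminus: "Polynomial.smult [:- c:] P = - Polynomial.smult [:c:] P"
  for P :: "'a::comm_ring_1 poly poly"
  using smult_minus_left[of "[:c:]" P] by simp

section \<open>The embedding into a skew Laurent ring\<close>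

text \<open>
  The module is the skew Laurent ring \<open>Q[t, t\<^sup>-\<^sup>1; \<sigma>]\<close> over \<open>Q = k[w][x]\<close> with \<open>\<sigma> = lsub \<rho> \<nu> \<mu>\<close>, a
  function \<open>f\<close> standing for the formal sum of the \<open>f n t\<^sup>n\<close>; \<open>u\<close> and \<open>d\<close> act as left
  multiplication by \<open>t\<close> and by \<open>Y 0 t\<^sup>-\<^sup>1\<close>, where \<open>Y n = \<sigma>\<^sup>n (du)\<close>.
\<close>

definition fscale :: "'k::field_char_0 \<Rightarrow> (int \<Rightarrow> 'k poly poly) \<Rightarrow> int \<Rightarrow> 'k poly poly" where
  "fscale c f = (\<lambda>n. Polynomial.smult [:c:] (f n))"

text \<open>One locale serves both root patterns: \<open>W\<close> and \<open>X\<close> are w1, w2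
  for distinct roots and w1, ud for a double root. The primed parameters describe the inverse of
  \<sigma>. As ud maps to \<open>Y 1\<close> and du to \<open>Y 0\<close>, the assumptions
  \<open>Y_W\<close> and \<open>Y_X\<close> send \<open>W\<close> and \<open>X\<close> to the
  variables, and \<open>Y_rec\<close> is what the defining relations become. The equations
  \<open>ud\<close> and \<open>du\<close> solve for these two products, and the five ideal
  memberships are rewriting rules; both serve to prove spanning.\<close>

locale du_model =
  fixes \<alpha> \<beta> \<rho> \<nu> \<mu> \<rho>' \<nu>' \<mu>' :: "'k::field_char_0" and Y :: "int \<Rightarrow> 'k poly poly"
    and W X :: "'k free_alg" and p1 q1 p2 q2 a1 b1 a2 b2 :: 'k
  assumes rho: "\<rho> * \<rho>' = 1" and nu: "\<nu> * \<nu>' = 1" and mu: "\<nu>' * \<mu> + \<mu>' * \<rho> = 0"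
    and Y_shift: "lsub \<rho> \<nu> \<mu> (Y n) = Y (n + 1)"
    and Y_rec: "Y n = Polynomial.smult [:\<alpha>:] (Y (n + 1)) + Polynomial.smult [:\<beta>:] (Y (n + 2))"
    and W: "W = fconst p1 * (fu * fd) + fconst q1 * (fd * fu)"
    and X: "X = fconst p2 * (fu * fd) + fconst q2 * (fd * fu)"
    and Y_W: "Polynomial.smult [:p1:] (Y 1) + Polynomial.smult [:q1:] (Y 0) = pw"
    and Y_X: "Polynomial.smult [:p2:] (Y 1) + Polynomial.smult [:q2:] (Y 0) = px"
    and ud: "fu * fd = fconst a1 * W + fconst b1 * X"
    and du: "fd * fu = fconst a2 * W + fconst b2 * X"
    and WX: "X * W - W * X \<in> du_ideal \<alpha> \<beta>"
    and uW: "fu * W - fconst \<rho> * (W * fu) \<in> du_ideal \<alpha> \<beta>"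
    and uX: "fu * X - (fconst \<nu> * X + fconst \<mu> * W) * fu \<in> du_ideal \<alpha> \<beta>"
    and dW: "fd * W - fconst \<rho>' * (W * fd) \<in> du_ideal \<alpha> \<beta>"
    and dX: "fd * X - (fconst \<nu>' * X + fconst \<mu>' * W) * fd \<in> du_ideal \<alpha> \<beta>"
begin

abbreviation I where "I \<equiv> du_ideal \<alpha> \<beta>"
abbreviation S where "S \<equiv> lsub \<rho> \<nu> \<mu>"
abbreviation S' where "S' \<equiv> lsub \<rho>' \<nu>' \<mu>'"

section \<open>The automorphism, its inverse, and the action on the skew Laurent ring\<close>

lemma S_S' [simp]: "S (S' P) = P"
  using lsub_compose[of \<rho> \<nu> \<mu> \<rho>' \<nu>' \<mu>' P] rho nu mu by (simp add: lsub_id)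

lemma S'_S [simp]: "S' (S P) = P"
proof -
  \<comment> \<open>Assumption \<open>mu\<close> covers only the other order of composition;
    multiplying the mixed coefficient by the unit \<rho> \<nu>' reduces this order to it.\<close>
  have "(\<nu> * \<mu>' + \<mu> * \<rho>') * (\<rho> * \<nu>') = (\<nu> * \<nu>') * (\<mu>' * \<rho>) + (\<rho> * \<rho>') * (\<nu>' * \<mu>)"
    by (simp add: algebra_simps)
  then have "(\<nu> * \<mu>' + \<mu> * \<rho>') * (\<rho> * \<nu>') = 0"
    using mu by (simp add: rho nu add.commute)
  moreover have "\<rho> * \<nu>' \<noteq> 0" using rho nu by auto
  ultimately have "\<nu> * \<mu>' + \<mu> * \<rho>' = 0" by simp
  then show ?thesis
    using lsub_compose[of \<rho>' \<nu>' \<mu>' \<rho> \<nu> \<mu> P] rho nu by (simp add: lsub_id mult.commute)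
qed

lemma Y_shift' [simp]: "S' (Y n) = Y (n - 1)"
  using Y_shift[of "n - 1"] S'_S[of "Y (n - 1)"] by simp

text \<open>Moving t past a coefficient applies \<sigma> and raises the exponent, so the value at
  \<open>n\<close> is taken from \<open>n - 1\<close>.\<close>

definition Lu :: "(int \<Rightarrow> 'k poly poly) \<Rightarrow> int \<Rightarrow> 'k poly poly" where
  "Lu f n = S (f (n - 1))"

definition Ld :: "(int \<Rightarrow> 'k poly poly) \<Rightarrow> int \<Rightarrow> 'k poly poly" where
  "Ld f n = Y 0 * S' (f (n + 1))"

sublocale free_alg_rep fscale Lu Ld
proof
  have add: "[:a + b:] = [:a:] + [:b:]" for a b :: 'k by simp
  have mult: "[:a * b:] = [:a:] * [:b:]" for a b :: 'k by simp
  show "fscale (a + b) f = fscale a f + fscale b f" for a b and f :: "int \<Rightarrow> 'k poly poly"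
    by (simp only: fscale_def add smult_add_left) (simp add: fun_eq_iff)
  show "fscale a (fscale b f) = fscale (a * b) f" for a b and f :: "int \<Rightarrow> 'k poly poly"
    unfolding fscale_def mult by simp
  show "fscale 1 f = f" for f :: "int \<Rightarrow> 'k poly poly"
    by (simp add: fscale_def flip: one_pCons)
qed (simp_all add: fscale_def Lu_def Ld_def fun_eq_iff lsub_add lsub_smult smult_add_right distrib_left)

lemma act_fu_apply: "act (fu * x) f n = S (act x f (n - 1))"
  by (subst act_fu_left) (rule Lu_def)

lemma act_fd_apply: "act (fd * x) f n = Y 0 * S' (act x f (n + 1))"
  by (subst act_fd_left) (rule Ld_def)

text \<open>This is the unit of the skew Laurent ring, so \<open>ev x\<close> is the image of
  \<open>x\<close> in that ring.\<close>

definition v0 :: "int \<Rightarrow> 'k poly poly" where "v0 = (\<lambda>n. if n = 0 then 1 else 0)"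
definition ev where "ev x = act x v0"

lemma act_ideal: "x \<in> I \<Longrightarrow> act x f = 0"
proof (rule act_du_ideal)
  \<comment> \<open>After cancelling \<open>S\<close> against \<open>S'\<close>, the relation for
    d^2u asks for \<open>Y (- 1)\<close> in terms of \<open>Y 0\<close>, \<open>Y 1\<close>, and the
    one for du^2 for \<open>Y 0\<close> in terms of \<open>Y 1\<close>, \<open>Y 2\<close>.\<close>
  note Y = Y_rec[of "- 1", simplified] Y_rec[of 0, simplified]
  show "Ld (Ld (Lu f)) = fscale \<alpha> (Ld (Lu (Ld f))) + fscale \<beta> (Lu (Ld (Ld f)))" for f
  proof
    fix n
    have "Ld (Ld (Lu f)) n = Y 0 * S' (f (n + 1)) * Y (- 1)"
      by (simp add: Lu_def Ld_def lsub_mult ac_simps)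
    also have "\<dots> = Y 0 * S' (f (n + 1)) * Polynomial.smult [:\<alpha>:] (Y 0)
        + Y 0 * S' (f (n + 1)) * Polynomial.smult [:\<beta>:] (Y 1)"
      by (simp only: Y(1) distrib_left)
    also have "\<dots> = (fscale \<alpha> (Ld (Lu (Ld f))) + fscale \<beta> (Lu (Ld (Ld f)))) n"
      by (simp add: Lu_def Ld_def fscale_def lsub_mult Y_shift distrib_left ac_simps)
    finally show "Ld (Ld (Lu f)) n = (fscale \<alpha> (Ld (Lu (Ld f))) + fscale \<beta> (Lu (Ld (Ld f)))) n" .
  qed
  show "Ld (Lu (Lu f)) = fscale \<alpha> (Lu (Ld (Lu f))) + fscale \<beta> (Lu (Lu (Ld f)))" for f
  proof
    fix n
    have "Ld (Lu (Lu f)) n = S (f (n - 1)) * Y 0"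
      by (simp add: Lu_def Ld_def lsub_mult ac_simps)
    also have "\<dots> = S (f (n - 1)) * Polynomial.smult [:\<alpha>:] (Y 1)
        + S (f (n - 1)) * Polynomial.smult [:\<beta>:] (Y 2)"
      by (simp only: Y(2) distrib_left)
    also have "\<dots> = (fscale \<alpha> (Lu (Ld (Lu f))) + fscale \<beta> (Lu (Lu (Ld f)))) n"
      by (simp add: Lu_def Ld_def fscale_def lsub_mult Y_shift distrib_left ac_simps)
    finally show "Ld (Lu (Lu f)) n = (fscale \<alpha> (Lu (Ld (Lu f))) + fscale \<beta> (Lu (Lu (Ld f)))) n" .
  qed
qed

lemma ev_ideal: "x \<in> I \<Longrightarrow> ev x = 0"
  by (simp add: ev_def act_ideal)

text \<open>Both ud and du keep the degree and multiply every coefficient by \<open>Y 1\<close> and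
  \<open>Y 0\<close> respectively; \<open>Y_W\<close> combines these into the variable w.\<close>

lemma act_W: "act W f = (\<lambda>n. pw * f n)"
proof -
  have "act W f n = (Polynomial.smult [:p1:] (Y 1) + Polynomial.smult [:q1:] (Y 0)) * f n" for n
    by (simp add: W act_add_left act_scale_left act_mult fscale_def Lu_def Ld_def lsub_mult
        Y_shift distrib_right)
  then show ?thesis by (intro ext) (simp only: Y_W)
qed

lemma act_X: "act X f = (\<lambda>n. px * f n)"
proof -
  have "act X f n = (Polynomial.smult [:p2:] (Y 1) + Polynomial.smult [:q2:] (Y 0)) * f n" for n
    by (simp add: X act_add_left act_scale_left act_mult fscale_def Lu_def Ld_def lsub_mult
        Y_shift distrib_right)
  then show ?thesis by (intro ext) (simp only: Y_X)
qed

lemma Y0_nonzero: "Y 0 \<noteq> 0"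
proof
  assume "Y 0 = 0"
  then have "Y 1 = 0" using Y_shift[of 0] by simp
  with \<open>Y 0 = 0\<close> Y_W show False by simp
qed

lemma Y_nonzero: "Y n \<noteq> 0"
proof (cases "n \<ge> 0")
  case True
  then show ?thesis
  proof (induction n rule: int_ge_induct)
    case (step i)
    then show ?case using Y_shift'[of "i + 1"] by (metis add_diff_cancel_right' lsub_0)
  qed (rule Y0_nonzero)
next
  case False
  then have "n \<le> 0" by simp
  then show ?thesis
  proof (induction n rule: int_le_induct)
    case (step i)
    then show ?case using Y_shift[of "i - 1"] by auto
  qed (rule Y0_nonzero)
qed

section \<open>Normal monomials and their independence\<close>

definition G :: "int \<Rightarrow> 'k free_alg" where
  "G n = (if n \<ge> 0 then fu ^ nat n else fd ^ nat (- n))"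

text \<open>From (y t^(-1))^k = y \<sigma>^(-1)(y) ... \<sigma>^(1-k)(y) t^(-k): the coefficient of
  the image of d^k. The product is empty for n \<ge> 0, where u^n maps to t^n itself.\<close>

definition cf :: "int \<Rightarrow> 'k poly poly" where
  "cf n = (\<Prod>m<nat (- n). Y (- int m))"

lemma cf_nonzero: "cf n \<noteq> 0"
  by (simp add: cf_def Y_nonzero)

lemma ev_G: "ev (G n) = (\<lambda>m. if m = n then cf n else 0)"
proof -
  have up: "act (fu ^ k) v0 m = (if m = int k then 1 else 0)" for k m
  proof (induction k arbitrary: m)
    case (Suc k)
    then show ?case by (auto simp: act_fu_apply simp del: act_fu_left)
  qed (simp add: v0_def)
  have down: "act (fd ^ k) v0 m = (if m = - int k then (\<Prod>l<k. Y (- int l)) else 0)" for k m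
  proof (induction k arbitrary: m)
    case (Suc k)
    have eq: "- int k - 1 = - 1 - int k" for k by simp
    have "S' (\<Prod>l<k. Y (- int l)) = (\<Prod>l<k. Y (- int (Suc l)))"
      by (induction k) (simp_all add: lsub_mult eq)
    then have "Y 0 * S' (\<Prod>l<k. Y (- int l)) = (\<Prod>l<Suc k. Y (- int l))"
      by (simp only: prod.lessThan_Suc_shift) simp
    then show ?case using Suc by (auto simp: act_fd_apply simp del: prod.lessThan_Suc act_fd_left)
  qed (simp add: v0_def)
  show ?thesis
    by (cases "n \<ge> 0") (auto simp: ev_def G_def up down cf_def fun_eq_iff)
qed

definition N :: "nat \<times> nat \<times> int \<Rightarrow> 'k free_alg" where
  "N = (\<lambda>(i, j, n). W ^ i * X ^ j * G n)"

lemma ev_N: "ev (N (i, j, n)) = (\<lambda>m. if m = n then monom (monom 1 i) j * cf n else 0)"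
proof -
  have Wi: "(act W ^^ i) f = (\<lambda>m. pw ^ i * f m)" for f
    by (induction i) (simp_all add: act_W mult.assoc fun_eq_iff)
  have Xj: "(act X ^^ j) f = (\<lambda>m. px ^ j * f m)" for f
    by (induction j) (simp_all add: act_X mult.assoc fun_eq_iff)
  have mon: "pw ^ i * px ^ j = (monom (monom 1 i) j :: 'k poly poly)"
    by (simp add: poly_const_pow monom_altdef)
  have "ev (N (i, j, n)) = act (W ^ i) (act (X ^ j) (ev (G n)))"
    by (simp only: ev_def N_def act_mult prod.case mult.assoc)
  also have "\<dots> = (\<lambda>m. pw ^ i * (px ^ j * (if m = n then cf n else 0)))"
    by (simp only: act_power Wi Xj ev_G)
  also have "\<dots> = (\<lambda>m. if m = n then pw ^ i * px ^ j * cf n else 0)"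
    by (simp only: fun_eq_iff mult.assoc if_distrib mult_zero_right) simp
  finally show ?thesis by (simp only: mon)
qed

text \<open>The degree \<open>n\<close> part of a combination of normal monomials, with the common
  factor \<open>cf n\<close> removed.\<close>

definition comp :: "(nat \<times> nat \<times> int) set \<Rightarrow> (nat \<times> nat \<times> int \<Rightarrow> 'k) \<Rightarrow> int \<Rightarrow> 'k poly poly" where
  "comp T c n = (\<Sum>(i, j, m)\<in>T. if m = n then monom (monom (c (i, j, m)) i) j else 0)"

lemma ev_comp: "ev (\<Sum>t\<in>T. fconst (c t) * N t) n = comp T c n * cf n"
proof -
  have "(\<Sum>t\<in>T. h t) n = (\<Sum>t\<in>T. h t n)" for h :: "nat \<times> nat \<times> int \<Rightarrow> int \<Rightarrow> 'k poly poly"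
    by (induction T rule: infinite_finite_induct) simp_all
  then have "ev (\<Sum>t\<in>T. fconst (c t) * N t) n = (\<Sum>t\<in>T. fscale (c t) (ev (N t)) n)"
    by (simp only: ev_def act_sum_left act_scale_left)
  also have "\<dots> = (\<Sum>(i, j, m)\<in>T. (if m = n then monom (monom (c (i, j, m)) i) j else 0) * cf n)"
  proof (rule sum.cong)
    fix t :: "nat \<times> nat \<times> int"
    obtain i j m where t: "t = (i, j, m)" by (cases t)
    have "Polynomial.smult [:c t:] (monom (monom 1 i) j * cf n) = monom (monom (c t) i) j * cf n"
      by (simp add: smult_monom flip: mult_smult_left)
    then show "fscale (c t) (ev (N t)) n =
        (case t of (i, j, m) \<Rightarrow> (if m = n then monom (monom (c (i, j, m)) i) j else 0) * cf n)"
      by (cases "m = n") (simp_all add: t ev_N fscale_def)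
  qed simp
  finally show ?thesis by (simp add: comp_def sum_distrib_right case_prod_unfold)
qed

lemma coeff_comp:
  assumes "finite T"
  shows "coeff (coeff (comp T c n) j) i = (if (i, j, n) \<in> T then c (i, j, n) else 0)"
proof -
  have "coeff (coeff (comp T c n) j) i = (\<Sum>t\<in>T. if t = (i, j, n) then c t else 0)"
    by (auto simp: comp_def coeff_sum intro!: sum.cong)
  then show ?thesis using assms by (simp add: sum.delta)
qed

text \<open>In a fixed degree the images are distinct monomials in w and x times the same nonzero
  \<open>cf n\<close>, which cancels in a domain.\<close>

lemma N_independent:
  assumes "finite T" "(\<Sum>t\<in>T. fconst (c t) * N t) \<in> I"
  shows "\<forall>t\<in>T. c t = 0"
proof
  fix t assume t: "t \<in> T"
  obtain i j n where ijn: "t = (i, j, n)" by (cases t)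
  have "comp T c n * cf n = 0"
    using ev_ideal[OF assms(2)] ev_comp[of c T n] by simp
  then have "comp T c n = 0" using cf_nonzero by simp
  then show "c t = 0" using coeff_comp[OF assms(1), of c n j i] t ijn by simp
qed

section \<open>Normal monomials span\<close>

inductive_set NF :: "'k free_alg set" where
  ideal: "x \<in> I \<Longrightarrow> x \<in> NF"
| gen: "G n \<in> NF"
| add: "x \<in> NF \<Longrightarrow> y \<in> NF \<Longrightarrow> x + y \<in> NF"
| scale: "x \<in> NF \<Longrightarrow> fconst c * x \<in> NF"
| W: "x \<in> NF \<Longrightarrow> W * x \<in> NF"
| X: "x \<in> NF \<Longrightarrow> X * x \<in> NF"

lemma NF_cong: "y \<in> NF \<Longrightarrow> x - y \<in> I \<Longrightarrow> x \<in> NF"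
  using NF.add[OF NF.ideal, of "x - y" y] by simp

lemma NF_WX: "x \<in> NF \<Longrightarrow> (fconst a * W + fconst b * X) * x \<in> NF"
  by (simp add: distrib_right mult.assoc NF.intros)

lemma NF_XW: "x \<in> NF \<Longrightarrow> (fconst b * X + fconst a * W) * x \<in> NF"
  using NF_WX[of x a b] by (simp add: add.commute)

text \<open>The letter u is moved to the right past \<open>W\<close> and \<open>X\<close> until it
  meets \<open>G n\<close>. There it lengthens a power of u or, for n < 0, forms ud, a combination
  of \<open>W\<close> and \<open>X\<close>. Closure under \<open>W\<close> and \<open>X\<close> is
  built into \<open>NF\<close> to allow this induction.\<close>

lemma NF_fu: "x \<in> NF \<Longrightarrow> fu * x \<in> NF"
proof (induction rule: NF.induct)
  case (ideal x)
  then show ?case by (simp add: NF.ideal du_ideal_lmult)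
next
  case (gen n)
  show ?case
  proof (cases "n \<ge> 0")
    case True
    then have "fu * G n = G (n + 1)" by (simp add: G_def nat_add_distrib)
    then show ?thesis by (simp add: NF.gen)
  next
    case False
    then have "nat (- n) = Suc (nat (- (n + 1)))" by simp
    then have "fu * G n = fu * fd * G (n + 1)" using False by (auto simp: G_def mult.assoc)
    then show ?thesis using NF_WX[OF NF.gen] by (simp add: ud)
  qed
next
  case (add x y)
  then show ?case by (simp add: distrib_left NF.add)
next
  case (scale x c)
  then show ?case by (simp add: fconst_left_commute[of fu] NF.scale)
next
  case (W x)
  have "fu * (W * x) - fconst \<rho> * (W * (fu * x)) = (fu * W - fconst \<rho> * (W * fu)) * x"
    by (simp add: algebra_simps)
  then show ?case using W NF_cong[OF NF.scale[OF NF.W]] du_ideal_rmult[OF uW] by metis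
next
  case (X x)
  have "fu * (X * x) - (fconst \<nu> * X + fconst \<mu> * W) * (fu * x)
      = (fu * X - (fconst \<nu> * X + fconst \<mu> * W) * fu) * x"
    by (simp add: algebra_simps)
  then show ?case using X NF_cong[OF NF_XW] du_ideal_rmult[OF uX] by metis
qed

lemma NF_fd: "x \<in> NF \<Longrightarrow> fd * x \<in> NF"
proof (induction rule: NF.induct)
  case (ideal x)
  then show ?case by (simp add: NF.ideal du_ideal_lmult)
next
  case (gen n)
  show ?case
  proof (cases "n \<le> 0")
    case True
    then have "nat (- (n - 1)) = Suc (nat (- n))" by simp
    then have "fd * G n = G (n - 1)" using True by (cases "n = 0") (simp_all add: G_def)
    then show ?thesis by (simp add: NF.gen)
  next
    case False
    then have "nat n = Suc (nat (n - 1))" by simp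
    then have "fd * G n = fd * fu * G (n - 1)" using False by (auto simp: G_def mult.assoc)
    then show ?thesis using NF_WX[OF NF.gen] by (simp add: du)
  qed
next
  case (add x y)
  then show ?case by (simp add: distrib_left NF.add)
next
  case (scale x c)
  then show ?case by (simp add: fconst_left_commute[of fd] NF.scale)
next
  case (W x)
  have "fd * (W * x) - fconst \<rho>' * (W * (fd * x)) = (fd * W - fconst \<rho>' * (W * fd)) * x"
    by (simp add: algebra_simps)
  then show ?case using W NF_cong[OF NF.scale[OF NF.W]] du_ideal_rmult[OF dW] by metis
next
  case (X x)
  have "fd * (X * x) - (fconst \<nu>' * X + fconst \<mu>' * W) * (fd * x)
      = (fd * X - (fconst \<nu>' * X + fconst \<mu>' * W) * fd) * x"
    by (simp add: algebra_simps)
  then show ?case using X NF_cong[OF NF_XW] du_ideal_rmult[OF dX] by metis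
qed

lemma NF_all: "x \<in> NF"
proof (induction x rule: free_alg_induct)
  case one
  show ?case using NF.gen[of 0] by (simp add: G_def)
qed (simp_all add: NF.intros NF_fu NF_fd)

lemma X_W_power: "X * W ^ i - W ^ i * X \<in> I"
proof (induction i)
  case (Suc i)
  have "X * W ^ Suc i - W ^ Suc i * X = (X * W - W * X) * W ^ i + W * (X * W ^ i - W ^ i * X)"
    by (simp add: algebra_simps)
  then show ?case by (simp add: Suc WX du_ideal_add du_ideal_lmult du_ideal_rmult)
qed simp

lemma NF_in_span: "x \<in> NF \<Longrightarrow> x \<in> free_alg.span (I \<union> Set.range N)"
proof (induction rule: NF.induct)
  case (gen n)
  have "G n = N (0, 0, n)" by (simp add: N_def)
  then show ?case by (metis UnI2 free_alg.span_base rangeI)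
next
  case (W x)
  from W(2) show ?case
  proof (induction rule: free_alg.span_induct_alt)
    case (step c x y)
    have "W * x \<in> I \<union> Set.range N" using step(1)
    proof
      assume "x \<in> Set.range N"
      then obtain i j n where "x = N (i, j, n)" by auto
      then have "W * x = N (Suc i, j, n)" by (simp add: N_def mult.assoc)
      then show ?thesis by simp
    qed (simp add: du_ideal_lmult)
    then show ?case using step(2)
      by (simp add: distrib_left fconst_left_commute[of W] free_alg.span_add
          free_alg.span_scale free_alg.span_base)
  qed (simp add: free_alg.span_zero)
next
  case (X x)
  from X(2) show ?case
  proof (induction rule: free_alg.span_induct_alt)
    case (step c x y)
    have "X * x \<in> free_alg.span (I \<union> Set.range N)" using step(1)
    proof
      assume "x \<in> Set.range N"
      then obtain i j n where "x = N (i, j, n)" by auto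
      \<comment> \<open>In a normal monomial \<open>X\<close> stands to the right of
        \<open>W ^ i\<close>; carrying the new \<open>X\<close> past it costs only an element of the
        ideal.\<close>
      then have "X * x = (X * W ^ i - W ^ i * X) * (X ^ j * G n) + N (i, Suc j, n)"
        by (simp add: N_def algebra_simps)
      moreover have "(X * W ^ i - W ^ i * X) * (X ^ j * G n) \<in> I"
        by (rule du_ideal_rmult[OF X_W_power])
      ultimately show ?thesis by (simp add: free_alg.span_add free_alg.span_base)
    qed (simp add: du_ideal_lmult free_alg.span_base)
    then show ?case using step(2)
      by (simp add: distrib_left fconst_left_commute[of X] free_alg.span_add free_alg.span_scale)
  qed (simp add: free_alg.span_zero)
qed (simp_all add: free_alg.span_add free_alg.span_scale free_alg.span_base)

lemma normal_form: "\<exists>T c. finite T \<and> x - (\<Sum>t\<in>T. fconst (c t) * N t) \<in> I"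
  by (rule span_mod_ideal) (rule NF_in_span[OF NF_all])

text \<open>Faithfulness of the embedding: \<open>ev\<close> ignores the ideal part of a normal form
  and detects every coefficient of the rest.\<close>

lemma ev_eq_0_iff: "ev x = 0 \<longleftrightarrow> x \<in> I"
proof
  assume ev0: "ev x = 0"
  obtain T c where T: "finite T" "x - (\<Sum>t\<in>T. fconst (c t) * N t) \<in> I"
    using normal_form by blast
  have "ev (\<Sum>t\<in>T. fconst (c t) * N t) = 0"
    using ev_ideal[OF T(2)] ev0 by (simp add: ev_def act_diff_left)
  then have "comp T c n = 0" for n using ev_comp[of c T n] cf_nonzero by simp
  then have "c t = 0" if "t \<in> T" for t
    using coeff_comp[OF T(1), of c "snd (snd t)" "fst (snd t)" "fst t"] that by simp
  then show "x \<in> I" using T(2) by simp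
qed (rule ev_ideal)

section \<open>Right multiplication and the cycle equations\<close>

lemma ev_fu_right: "ev (x * fu) = (\<lambda>n. ev x (n - 1))"
proof -
  have "ev (x * fu) = act x (Lu v0)" by (simp add: ev_def act_mult)
  also have "Lu v0 = (\<lambda>n. v0 (n - 1))" by (auto simp: Lu_def v0_def fun_eq_iff)
  also have "act x (\<lambda>n. v0 (n - 1)) = (\<lambda>n. ev x (n - 1))"
    unfolding ev_def
    by (rule act_commute[of "\<lambda>f n. f (n - 1)"]) (auto simp: fscale_def Lu_def Ld_def fun_eq_iff)
  finally show ?thesis .
qed

text \<open>As for u, right multiplication commutes with the left action and is determined by its
  effect on the unit. Here f t^n y t^(-1) = f \<sigma>^n(y) t^(n-1), so \<open>Y\<close> enters at
  the old exponent \<open>n + 1\<close>.\<close>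

lemma ev_fd_right: "ev (x * fd) = (\<lambda>n. ev x (n + 1) * Y (n + 1))"
proof -
  have "ev (x * fd) = act x (Ld v0)" by (simp add: ev_def act_mult)
  also have "Ld v0 = (\<lambda>n. v0 (n + 1) * Y (n + 1))"
    by (auto simp: Ld_def v0_def fun_eq_iff add_eq_0_iff)
  also have "act x (\<lambda>n. v0 (n + 1) * Y (n + 1)) = (\<lambda>n. ev x (n + 1) * Y (n + 1))"
    unfolding ev_def
    by (rule act_commute[of "\<lambda>f n. f (n + 1) * Y (n + 1)"])
       (auto simp: fscale_def Lu_def Ld_def fun_eq_iff lsub_mult Y_shift distrib_right
         distrib_left ac_simps)
  finally show ?thesis .
qed

text \<open>For a coefficient f in degree n the condition from d reads \<open>f * Y n\<close> +
  \<beta> \<open>Y 0 * S' f\<close> = 0. Given the eigenvector equation it becomes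
  \<open>f * (Y n - Y 0) = 0\<close>, which splits in a domain.\<close>

lemma cycle3_iff:
  "cycle3 \<alpha> \<beta> x \<longleftrightarrow>
    (\<forall>n. S (ev x n) = Polynomial.smult [:- \<beta>:] (ev x n) \<and> (ev x n = 0 \<or> Y n = Y 0))"
proof -
  let ?m = "ev x"
  have "fu * x + fconst \<beta> * (x * fu) \<in> I \<longleftrightarrow> (\<forall>n. S (?m n) = Polynomial.smult [:- \<beta>:] (?m n))"
  proof -
    have "ev (fu * x + fconst \<beta> * (x * fu)) n = S (?m (n - 1)) + Polynomial.smult [:\<beta>:] (?m (n - 1))" for n
      using ev_fu_right[of x]
      by (simp add: ev_def act_add_left act_scale_left fscale_def Lu_def)
    then have "fu * x + fconst \<beta> * (x * fu) \<in> I \<longleftrightarrow>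
        (\<forall>n. S (?m (n - 1)) + Polynomial.smult [:\<beta>:] (?m (n - 1)) = 0)"
      by (simp add: ev_eq_0_iff[symmetric] fun_eq_iff)
    also have "\<dots> \<longleftrightarrow> (\<forall>n. S (?m n) + Polynomial.smult [:\<beta>:] (?m n) = 0)"
      by (metis add_diff_cancel_right')
    finally show ?thesis by (simp add: smult_const_uminus eq_neg_iff_add_eq_0)
  qed
  moreover have "x * fd + fconst \<beta> * (fd * x) \<in> I \<longleftrightarrow>
      (\<forall>n. ?m n * Y n + Polynomial.smult [:\<beta>:] (Y 0 * S' (?m n)) = 0)"
  proof -
    have "ev (x * fd + fconst \<beta> * (fd * x)) n
        = ?m (n + 1) * Y (n + 1) + Polynomial.smult [:\<beta>:] (Y 0 * S' (?m (n + 1)))" for n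
      using ev_fd_right[of x]
      by (simp add: ev_def act_add_left act_scale_left fscale_def Ld_def)
    then have "x * fd + fconst \<beta> * (fd * x) \<in> I \<longleftrightarrow>
        (\<forall>n. ?m (n + 1) * Y (n + 1) + Polynomial.smult [:\<beta>:] (Y 0 * S' (?m (n + 1))) = 0)"
      by (simp add: ev_eq_0_iff[symmetric] fun_eq_iff)
    also have "\<dots> \<longleftrightarrow> (\<forall>n. ?m n * Y n + Polynomial.smult [:\<beta>:] (Y 0 * S' (?m n)) = 0)"
      by (metis diff_add_cancel)
    finally show ?thesis .
  qed
  moreover have "?m n * Y n + Polynomial.smult [:\<beta>:] (Y 0 * S' (?m n)) = 0 \<longleftrightarrow> ?m n = 0 \<or> Y n = Y 0"
    if "S (?m n) = Polynomial.smult [:- \<beta>:] (?m n)" for n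
  proof -
    \<comment> \<open>Applying \<open>S'\<close> to the eigenvector equation eliminates
      \<open>S'\<close> from the second condition without dividing by \<beta>.\<close>
    have "?m n = Polynomial.smult [:- \<beta>:] (S' (?m n))"
      using that S'_S[of "?m n"] by (simp add: lsub_smult)
    then have *: "Polynomial.smult [:\<beta>:] (S' (?m n)) = - ?m n"
      by (metis minus_minus smult_const_uminus)
    have "Polynomial.smult [:\<beta>:] (Y 0 * S' (?m n)) = - (Y 0 * ?m n)"
      using arg_cong[OF *, of "(*) (Y 0)"] by simp
    then have "?m n * Y n + Polynomial.smult [:\<beta>:] (Y 0 * S' (?m n)) = ?m n * (Y n - Y 0)"
      by (simp add: algebra_simps)
    then show ?thesis by simp
  qed
  ultimately show ?thesis unfolding cycle3_def by metis
qed

section \<open>From the cycle equations to vanishing and to bases of monomials\<close>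

lemma cycle3_trivial:
  assumes "\<And>i j. \<nu> ^ j * \<rho> ^ i \<noteq> - \<beta>" "cycle3 \<alpha> \<beta> x"
  shows "x \<in> I"
proof -
  have "ev x n = 0" for n
    using assms rho nu
    by (intro lsub_eigenvector_zero[of \<nu> \<rho> \<mu> _ "- \<beta>"]) (auto simp: cycle3_iff)
  then show ?thesis by (simp add: ev_eq_0_iff[symmetric] fun_eq_iff)
qed

text \<open>A solution need not be a monomial; \<open>support\<close> demands that every monomial
  occurring in a solution lies in \<open>J\<close>, so cutting the normal form of a cycle down to
  \<open>J\<close> loses nothing.\<close>

lemma HH3_basis_N:
  assumes cycle: "\<And>i j n. (i, j, n) \<in> J \<Longrightarrow> Y n = Y 0 \<and>
      S (monom (monom 1 i) j * cf n) = Polynomial.smult [:- \<beta>:] (monom (monom 1 i) j * cf n)"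
    and support: "\<And>P i j n. Y n = Y 0 \<Longrightarrow> S (P * cf n) = Polynomial.smult [:- \<beta>:] (P * cf n) \<Longrightarrow>
      coeff (coeff P j) i \<noteq> 0 \<Longrightarrow> (i, j, n) \<in> J"
  shows "vectorspace.basis class_ring (HH3 \<alpha> \<beta>) ((\<lambda>t. free_tensor \<alpha> \<beta> (N t)) ` J)"
proof (rule HH3_basisI)
  fix t assume "t \<in> J"
  then show "cycle3 \<alpha> \<beta> (N t)"
    using cycle by (cases t) (auto simp: cycle3_iff ev_N)
next
  show "\<forall>t\<in>T. c t = 0" if "finite T" "(\<Sum>t\<in>T. fconst (c t) * N t) \<in> I" for T c
    using N_independent that .
next
  fix x assume x: "cycle3 \<alpha> \<beta> x"
  obtain T c where T: "finite T" "x - (\<Sum>t\<in>T. fconst (c t) * N t) \<in> I"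
    using normal_form by blast
  have "ev x = ev (\<Sum>t\<in>T. fconst (c t) * N t)"
    using ev_ideal[OF T(2)] by (simp add: ev_def act_diff_left)
  then have ev: "ev x n = comp T c n * cf n" for n by (simp add: ev_comp)
  have "t \<in> J" if "t \<in> T" "c t \<noteq> 0" for t
  proof -
    obtain i j n where t: "t = (i, j, n)" by (cases t)
    have ij: "coeff (coeff (comp T c n) j) i \<noteq> 0"
      using that t by (simp add: coeff_comp T)
    then have "comp T c n * cf n \<noteq> 0" using cf_nonzero by auto
    then show ?thesis
      using support[OF _ _ ij] x t by (auto simp: cycle3_iff ev)
  qed
  then have "(\<Sum>t\<in>T. fconst (c t) * N t) = (\<Sum>t\<in>T \<inter> J. fconst (c t) * N t)"
    by (intro sum.mono_neutral_right) (use T in auto)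
  then show "\<exists>T c. finite T \<and> T \<subseteq> J \<and> x - (\<Sum>t\<in>T. fconst (c t) * N t) \<in> I"
    using T by (intro exI[of _ "T \<inter> J"] exI[of _ c]) auto
qed

text \<open>Telescoping: for n < 0, applying \<sigma> to
  \<open>Y 0 * Y (- 1) * ... * Y (n + 1)\<close> gains the factor \<open>Y 1\<close> and loses
  \<open>Y (n + 1)\<close>, and these agree once \<open>Y n = Y 0\<close>.\<close>

lemma S_cf:
  assumes "Y n = Y 0"
  shows "S (cf n) = cf n"
proof (cases "n \<ge> 0")
  case False
  have shift: "S (\<Prod>m<k. Y (- int m)) * Y (1 - int k) = Y 1 * (\<Prod>m<k. Y (- int m))" for k
  proof (induction k)
    case (Suc k)
    have "S (\<Prod>m<Suc k. Y (- int m)) * Y (1 - int (Suc k))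
        = S (\<Prod>m<k. Y (- int m)) * Y (1 - int k) * Y (- int k)"
      using Y_shift[of "- int k"] by (simp add: lsub_mult)
    then show ?case by (simp add: Suc)
  qed simp
  have "Y (1 + n) = Y 1"
    using Y_shift[of n] Y_shift[of 0] assms by (simp add: add.commute)
  then have "S (cf n) * Y 1 = Y 1 * cf n"
    using shift[of "nat (- n)"] False by (simp add: cf_def)
  then show ?thesis using Y_nonzero[of 1] by simp
qed (simp add: cf_def)

text \<open>At \<beta> = -1 the eigenvalue is 1, and in the admissible degrees \<open>cf n\<close>
  is itself invariant, so it cancels from the equation.\<close>

lemma HH3_basis_fixed:
  assumes "\<beta> = - 1"
    and cycle: "\<And>i j n. (i, j, n) \<in> J \<Longrightarrow>
      Y n = Y 0 \<and> S (monom (monom 1 i) j) = monom (monom 1 i) j"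
    and support: "\<And>P i j n. Y n = Y 0 \<Longrightarrow> S P = P \<Longrightarrow>
      coeff (coeff P j) i \<noteq> 0 \<Longrightarrow> (i, j, n) \<in> J"
  shows "vectorspace.basis class_ring (HH3 \<alpha> \<beta>) ((\<lambda>t. free_tensor \<alpha> \<beta> (N t)) ` J)"
proof (rule HH3_basis_N)
  have one: "Polynomial.smult [:- \<beta>:] P = P" for P :: "'k poly poly"
    using assms(1) by (simp flip: one_pCons)
  show "Y n = Y 0 \<and>
      S (monom (monom 1 i) j * cf n) = Polynomial.smult [:- \<beta>:] (monom (monom 1 i) j * cf n)"
    if "(i, j, n) \<in> J" for i j n
    using cycle[OF that] S_cf[of n] by (simp only: lsub_mult one)
  show "(i, j, n) \<in> J" if Y: "Y n = Y 0"
    and S: "S (P * cf n) = Polynomial.smult [:- \<beta>:] (P * cf n)"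
    and c: "coeff (coeff P j) i \<noteq> 0" for P i j n
  proof (rule support[OF Y _ c])
    have "S P * cf n = P * cf n" using S S_cf[OF Y] by (simp only: lsub_mult one)
    then show "S P = P" using cf_nonzero by simp
  qed
qed

end

section \<open>Relations of the normal elements\<close>

lemma du_rel_ddu:
  "fd * fd * fu - (fconst \<alpha> * (fd * fu * fd) + fconst \<beta> * (fu * fd * fd)) \<in> du_ideal \<alpha> \<beta>"
  and du_rel_duu:
  "fd * fu * fu - (fconst \<alpha> * (fu * fd * fu) + fconst \<beta> * (fu * fu * fd)) \<in> du_ideal \<alpha> \<beta>"
  by (simp_all add: du_relators_in_ideal du_relators_def)

lemmas fconst_normalize =
  fconst_commute[of fu] fconst_commute[of fd] fconst_left_commute[of fu] fconst_left_commute[of fd]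

text \<open>Multiply the relator of d^2u by u on the left and that of du^2 by d on the right: the
  terms with \<alpha> and \<beta> coincide and drop out of the difference.\<close>

lemma ud_du_commute: "fu * fd * (fd * fu) - fd * fu * (fu * fd) \<in> du_ideal \<alpha> \<beta>"
proof -
  let ?R = "fd * fd * fu - (fconst \<alpha> * (fd * fu * fd) + fconst \<beta> * (fu * fd * fd))"
  let ?T = "fd * fu * fu - (fconst \<alpha> * (fu * fd * fu) + fconst \<beta> * (fu * fu * fd))"
  have "fu * fd * (fd * fu) - fd * fu * (fu * fd) = fu * ?R - ?T * fd"
    by (simp add: algebra_simps fconst_normalize)
  then show ?thesis
    by (simp only: du_ideal_diff du_ideal_lmult du_ideal_rmult du_rel_ddu du_rel_duu)
qed

lemma lin_w_factor: "lin_w (- (r * s)) r = fconst r * (fd * fu - fconst s * (fu * fd))"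
  by (simp add: lin_w_def fconst_uminus fconst_mult algebra_simps)

text \<open>Factoring the characteristic polynomial turns the relators themselves into commutation
  rules: both expressions are nonzero scalar multiples of a relator.\<close>

lemma lin_w_commute:
  fixes r s :: "'k::field_char_0"
  assumes "\<alpha> = r + s" "\<beta> = - (r * s)" "r \<noteq> 0"
  shows "fu * lin_w \<beta> r - fconst (1 / r) * (lin_w \<beta> r * fu) \<in> du_ideal \<alpha> \<beta>"
    and "fd * lin_w \<beta> r - fconst r * (lin_w \<beta> r * fd) \<in> du_ideal \<alpha> \<beta>"
proof -
  define R S where "R = fconst r" and "S = fconst s"
  let ?v = "fd * fu - S * (fu * fd)"
  have w: "lin_w \<beta> r = R * ?v" by (simp add: assms lin_w_factor R_def S_def)
  have ab: "fconst \<alpha> = R + S" "fconst \<beta> = - (R * S)"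
    by (simp_all add: assms R_def S_def fconst_add fconst_uminus fconst_mult)
  have SR: "S * R = R * S" "S * (R * x) = R * (S * x)" for x
    using fconst_commute[of S r] fconst_left_commute[of S r x] by (simp_all add: R_def)
  have norm: "fu * R = R * fu" "fu * S = S * fu" "fd * R = R * fd" "fd * S = S * fd"
    "fu * (R * x) = R * (fu * x)" "fu * (S * x) = S * (fu * x)"
    "fd * (R * x) = R * (fd * x)" "fd * (S * x) = S * (fd * x)" for x
    by (simp_all add: R_def S_def fconst_normalize)
  have "fconst (1 / r) * R = 1"
    using assms(3) by (simp add: R_def flip: fconst_mult)
  then have inv: "fconst (1 / r) * (R * x) = x" for x by (simp flip: mult.assoc)
  have "fu * lin_w \<beta> r - fconst (1 / r) * (lin_w \<beta> r * fu) = fu * (R * ?v) - ?v * fu"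
    unfolding w by (simp only: mult.assoc inv)
  also have "\<dots> = - (fd * fu * fu - (fconst \<alpha> * (fu * fd * fu) + fconst \<beta> * (fu * fu * fd)))"
    unfolding ab by (simp add: algebra_simps norm SR)
  finally show "fu * lin_w \<beta> r - fconst (1 / r) * (lin_w \<beta> r * fu) \<in> du_ideal \<alpha> \<beta>"
    by (simp only: du_ideal_uminus du_rel_duu)
  have "fd * lin_w \<beta> r - fconst r * (lin_w \<beta> r * fd)
      = R * (fd * fd * fu - (fconst \<alpha> * (fd * fu * fd) + fconst \<beta> * (fu * fd * fd)))"
    unfolding w ab R_def[symmetric] by (simp add: algebra_simps norm SR)
  then show "fd * lin_w \<beta> r - fconst r * (lin_w \<beta> r * fd) \<in> du_ideal \<alpha> \<beta>"
    by (simp only: du_ideal_lmult du_rel_ddu)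
qed

section \<open>Distinct roots\<close>

text \<open>Since du = (w1 - w2) / (r1 - r2), and \<sigma> divides w1 by r1 and w2 by r2, this is
  \<sigma>^n(du).\<close>

definition Y_distinct :: "'k \<Rightarrow> 'k \<Rightarrow> int \<Rightarrow> 'k::field_char_0 poly poly" where
  "Y_distinct r1 r2 n =
    [:[:0, r1 powi (- n) / (r1 - r2):], [:- (r2 powi (- n)) / (r1 - r2):]:]"

lemma powi_recurrence:
  fixes r :: "'k::field_char_0"
  assumes "r \<noteq> 0" "r ^ 2 = \<alpha> * r + \<beta>"
  shows "r powi (- n) = \<alpha> * r powi (- (n + 1)) + \<beta> * r powi (- (n + 2))"
proof -
  have shift: "- (n + 2) + 2 = - n" "- (n + 2) + 1 = - (n + 1)" by simp_all
  have "r powi (- n) = r powi (- (n + 2)) * r ^ 2"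
    using assms(1) power_int_add[of r "- (n + 2)" 2] by (simp only: shift) simp
  moreover have "r powi (- (n + 1)) = r powi (- (n + 2)) * r"
    using assms(1) power_int_add[of r "- (n + 2)" 1] by (simp only: shift) simp
  ultimately show ?thesis using assms(2) by (simp add: algebra_simps)
qed

lemma powi_minus_succ:
  fixes r :: "'k::field_char_0"
  assumes "r \<noteq> 0"
  shows "r powi (- (n + 1)) = r powi (- n) / r"
  using assms power_int_add[of r "- n" "- 1"] by (simp add: field_simps)

text \<open>The last four constants solve the 2 by 2 system defining w1 and w2 for ud and du; it is
  invertible because the roots are distinct and nonzero.\<close>

lemma du_model_distinct:
  fixes r1 r2 :: "'k::field_char_0"
  assumes r: "r1 \<noteq> 0" "r2 \<noteq> 0" "r1 \<noteq> r2" and ab: "\<alpha> = r1 + r2" "\<beta> = - (r1 * r2)"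
  shows "du_model \<alpha> \<beta> (1 / r1) (1 / r2) 0 r1 r2 0 (Y_distinct r1 r2)
    (lin_w \<beta> r1) (lin_w \<beta> r2) \<beta> r1 \<beta> r2
    (1 / (r1 * (r1 - r2))) (- 1 / (r2 * (r1 - r2))) (1 / (r1 - r2)) (- 1 / (r1 - r2))"
proof
  show "1 / r1 * r1 = 1" "1 / r2 * r2 = 1" "r2 * 0 + 0 * (1 / r1) = 0"
    using r ab by simp_all
  show "lsub (1 / r1) (1 / r2) 0 (Y_distinct r1 r2 n) = Y_distinct r1 r2 (n + 1)" for n
    using powi_minus_succ[OF r(1), of n] powi_minus_succ[OF r(2), of n]
    by (simp add: Y_distinct_def lsub_pCons pcompose_pCons)
  have "r1 ^ 2 = \<alpha> * r1 + \<beta>" "r2 ^ 2 = \<alpha> * r2 + \<beta>"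
    by (simp_all add: ab power2_eq_square algebra_simps)
  then show "Y_distinct r1 r2 n = Polynomial.smult [:\<alpha>:] (Y_distinct r1 r2 (n + 1))
      + Polynomial.smult [:\<beta>:] (Y_distinct r1 r2 (n + 2))" for n
    using powi_recurrence[OF r(1), of \<alpha> \<beta> n] powi_recurrence[OF r(2), of \<alpha> \<beta> n]
    by (simp add: Y_distinct_def add_divide_distrib diff_divide_distrib mult.commute)
  show "lin_w \<beta> r1 = fconst \<beta> * (fu * fd) + fconst r1 * (fd * fu)"
    "lin_w \<beta> r2 = fconst \<beta> * (fu * fd) + fconst r2 * (fd * fu)"
    by (simp_all add: lin_w_def)
  show "Polynomial.smult [:\<beta>:] (Y_distinct r1 r2 1) + Polynomial.smult [:r1:] (Y_distinct r1 r2 0) = pw"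
    "Polynomial.smult [:\<beta>:] (Y_distinct r1 r2 1) + Polynomial.smult [:r2:] (Y_distinct r1 r2 0) = px"
    using r by (simp_all add: Y_distinct_def power_int_minus ab divide_simps pCons_one)
  have expand: "fconst a * lin_w \<beta> r1 + fconst b * lin_w \<beta> r2
      = fconst (a * \<beta> + b * \<beta>) * (fu * fd) + fconst (a * r1 + b * r2) * (fd * fu)" for a b
    by (simp add: lin_w_def fconst_add distrib_left distrib_right flip: mult.assoc fconst_mult)
  have "1 / (r1 * (r1 - r2)) * \<beta> + - 1 / (r2 * (r1 - r2)) * \<beta> = 1"
    "1 / (r1 * (r1 - r2)) * r1 + - 1 / (r2 * (r1 - r2)) * r2 = 0"
    "1 / (r1 - r2) * \<beta> + - 1 / (r1 - r2) * \<beta> = 0"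
    "1 / (r1 - r2) * r1 + - 1 / (r1 - r2) * r2 = 1"
    using r by (simp_all add: ab divide_simps)
  then show "fu * fd = fconst (1 / (r1 * (r1 - r2))) * lin_w \<beta> r1
      + fconst (- 1 / (r2 * (r1 - r2))) * lin_w \<beta> r2"
    "fd * fu = fconst (1 / (r1 - r2)) * lin_w \<beta> r1 + fconst (- 1 / (r1 - r2)) * lin_w \<beta> r2"
    unfolding expand by simp_all
  have "lin_w \<beta> r2 * lin_w \<beta> r1 - lin_w \<beta> r1 * lin_w \<beta> r2
      = fconst (\<beta> * (r1 - r2)) * (fu * fd * (fd * fu) - fd * fu * (fu * fd))"
    by (simp add: lin_w_def fconst_diff fconst_mult algebra_simps fconst_normalize)
       (simp add: mult.assoc[symmetric] fconst_mult[symmetric] mult.commute)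
  then show "lin_w \<beta> r2 * lin_w \<beta> r1 - lin_w \<beta> r1 * lin_w \<beta> r2 \<in> du_ideal \<alpha> \<beta>"
    by (simp only: du_ideal_lmult ud_du_commute)
  note c1 = lin_w_commute[OF ab r(1)]
  note c2 = lin_w_commute[of \<alpha> r2 r1 \<beta>]
  show "fu * lin_w \<beta> r1 - fconst (1 / r1) * (lin_w \<beta> r1 * fu) \<in> du_ideal \<alpha> \<beta>"
    "fd * lin_w \<beta> r1 - fconst r1 * (lin_w \<beta> r1 * fd) \<in> du_ideal \<alpha> \<beta>" by fact+
  show "fu * lin_w \<beta> r2 - (fconst (1 / r2) * lin_w \<beta> r2 + fconst 0 * lin_w \<beta> r1) * fu \<in> du_ideal \<alpha> \<beta>"
    "fd * lin_w \<beta> r2 - (fconst r2 * lin_w \<beta> r2 + fconst 0 * lin_w \<beta> r1) * fd \<in> du_ideal \<alpha> \<beta>"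
    using c2 r ab by (simp_all add: mult.assoc mult.commute[of r1 r2] add.commute)
qed

text \<open>With \<open>r2 = 1 / r1\<close> the monomial w1^i w2^j has eigenvalue r1^(j-i), and the
  coefficients of \<open>Y n\<close> involve r1^(-n) and r1^n. Hence both conditions concern powers
  of \<open>r1\<close> only, and diagonality tests each monomial separately.\<close>

lemma HH3_basis_distinct:
  fixes r1 r2 :: "'k::field_char_0"
  assumes r: "r1 \<noteq> 0" "r1 \<noteq> r2" and prod: "r1 * r2 = 1" and ab: "\<alpha> = r1 + r2" "\<beta> = - 1"
  shows "vectorspace.basis class_ring (HH3 \<alpha> \<beta>)
    ((\<lambda>(i, j, n). free_tensor \<alpha> \<beta> (lin_w \<beta> r1 ^ i * lin_w \<beta> r2 ^ j *
      (if n \<ge> 0 then fu ^ nat n else fd ^ nat (- n)))) `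
     {(i, j, n). r1 ^ i = r1 ^ j \<and> r1 powi n = 1})"
proof -
  have r2: "r2 \<noteq> 0" "r2 = 1 / r1" using prod r by (auto simp: field_simps)
  interpret du_model \<alpha> \<beta> "1 / r1" "1 / r2" 0 r1 r2 0 "Y_distinct r1 r2" "lin_w \<beta> r1" "lin_w \<beta> r2"
    \<beta> r1 \<beta> r2 "1 / (r1 * (r1 - r2))" "- 1 / (r2 * (r1 - r2))" "1 / (r1 - r2)" "- 1 / (r1 - r2)"
    using r r2 ab prod by (intro du_model_distinct) simp_all
  have Y: "Y_distinct r1 r2 n = Y_distinct r1 r2 0 \<longleftrightarrow> r1 powi n = 1" for n
    using r by (auto simp: Y_distinct_def r2 power_int_minus power_int_divide_distrib field_simps)
  have eig: "(1 / r2) ^ j * (1 / r1) ^ i = 1 \<longleftrightarrow> r1 ^ i = r1 ^ j" for i j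
    using r by (auto simp: r2 power_divide divide_simps)
  let ?J = "{(i, j, n). r1 ^ i = r1 ^ j \<and> r1 powi n = 1}"
  have "vectorspace.basis class_ring (HH3 \<alpha> \<beta>) ((\<lambda>t. free_tensor \<alpha> \<beta> (N t)) ` ?J)"
  proof (rule HH3_basis_fixed[OF ab(2)])
    fix i j :: nat and n :: int assume "(i, j, n) \<in> ?J"
    then show "Y_distinct r1 r2 n = Y_distinct r1 r2 0 \<and>
        lsub (1 / r1) (1 / r2) 0 (monom (monom 1 i) j) = monom (monom 1 i) j"
      using eig[of j i] Y[of n] by (auto simp: poly_eq_iff[of "lsub _ _ _ _"]
          poly_eq_iff[of "coeff (lsub _ _ _ _) _"] coeff_lsub_diagonal)
  next
    fix P :: "'k poly poly" and i j :: nat and n :: int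
    assume Yn: "Y_distinct r1 r2 n = Y_distinct r1 r2 0"
      and P: "lsub (1 / r1) (1 / r2) 0 P = P" and c: "coeff (coeff P j) i \<noteq> 0"
    have "(1 / r2) ^ j * (1 / r1) ^ i * coeff (coeff P j) i = coeff (coeff P j) i"
      using coeff_lsub_diagonal[of "1 / r1" "1 / r2" P j i] P by simp
    then show "(i, j, n) \<in> ?J" using c eig[of j i] Yn Y by simp
  qed
  then show ?thesis by (simp add: N_def G_def case_prod_unfold)
qed

section \<open>A double root\<close>

text \<open>Here du = w / r + r ud, and iterating w to w / r and ud to ud / r - w / r^3 gives
  \<sigma>^n(du); the factor linear in \<open>n\<close> comes from the Jordan block.\<close>

definition Y_double :: "'k \<Rightarrow> int \<Rightarrow> 'k::field_char_0 poly poly" where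
  "Y_double r n = [:[:0, (1 - of_int n) / r * r powi (- n):], [:r * r powi (- n):]:]"

text \<open>The constant \<open>- 1 / r ^ 3\<close> arises by solving the relation for du^2 for
  u(ud), which gives u(ud) = ((2 / r) ud - (1 / r^2) du) u, and then substituting du = w / r + r
  ud.\<close>

lemma du_model_double:
  fixes r :: "'k::field_char_0"
  assumes r: "r \<noteq> 0" and ab: "\<alpha> = r + r" "\<beta> = - (r * r)"
  shows "du_model \<alpha> \<beta> (1 / r) (1 / r) (- 1 / r ^ 3) r r (1 / r) (Y_double r)
    (lin_w \<beta> r) (fu * fd) \<beta> r 1 0 0 1 (1 / r) r"
proof
  show "1 / r * r = 1" "r * (- 1 / r ^ 3) + 1 / r * (1 / r) = 0"
    using r ab by (simp_all add: power3_eq_cube)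
  show "lsub (1 / r) (1 / r) (- 1 / r ^ 3) (Y_double r n) = Y_double r (n + 1)" for n
    using powi_minus_succ[OF r, of n] r
    by (simp add: Y_double_def lsub_pCons pcompose_pCons field_simps power3_eq_cube)
  show "Y_double r n = Polynomial.smult [:\<alpha>:] (Y_double r (n + 1))
      + Polynomial.smult [:\<beta>:] (Y_double r (n + 2))" for n
  proof -
    define z where "z = r powi (- (n + 2))"
    have "z = r powi (- (n + 1)) / r"
      unfolding z_def using powi_minus_succ[OF r, of "n + 1"] by (simp only: add.assoc one_add_one)
    then have "r powi (- (n + 1)) = r * z" using r by simp
    moreover from this have "r powi (- n) = r * (r * z)"
      using powi_minus_succ[OF r, of n] r by (simp add: field_simps)
    ultimately show ?thesis
      unfolding Y_double_def z_def[symmetric] using r by (simp add: ab field_simps)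
  qed
  show "lin_w \<beta> r = fconst \<beta> * (fu * fd) + fconst r * (fd * fu)"
    "fu * fd = fconst 1 * (fu * fd) + fconst 0 * (fd * fu)"
    "fu * fd = fconst 0 * lin_w \<beta> r + fconst 1 * (fu * fd)"
    by (simp_all add: lin_w_def)
  show "Polynomial.smult [:\<beta>:] (Y_double r 1) + Polynomial.smult [:r:] (Y_double r 0) = pw"
    "Polynomial.smult [:1:] (Y_double r 1) + Polynomial.smult [:0:] (Y_double r 0) = px"
    using r by (simp_all add: Y_double_def power_int_minus ab divide_simps pCons_one)
  have inv: "fconst (1 / r) * (fconst r * x) = x" for x
    using r by (simp flip: mult.assoc fconst_mult)
  have w: "lin_w \<beta> r = fconst r * (fd * fu - fconst r * (fu * fd))"
    by (simp add: ab lin_w_factor)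
  show "fd * fu = fconst (1 / r) * lin_w \<beta> r + fconst r * (fu * fd)"
    unfolding w inv by simp
  have "fu * fd * lin_w \<beta> r - lin_w \<beta> r * (fu * fd)
      = fconst r * (fu * fd * (fd * fu) - fd * fu * (fu * fd))"
    unfolding w by (simp add: algebra_simps fconst_normalize)
  then show "fu * fd * lin_w \<beta> r - lin_w \<beta> r * (fu * fd) \<in> du_ideal \<alpha> \<beta>"
    by (simp only: du_ideal_lmult ud_du_commute)
  note c = lin_w_commute[OF ab r]
  show "fu * lin_w \<beta> r - fconst (1 / r) * (lin_w \<beta> r * fu) \<in> du_ideal \<alpha> \<beta>"
    "fd * lin_w \<beta> r - fconst r * (lin_w \<beta> r * fd) \<in> du_ideal \<alpha> \<beta>" by fact+
  show "fu * (fu * fd) - (fconst (1 / r) * (fu * fd) + fconst (- 1 / r ^ 3) * lin_w \<beta> r) * fu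
      \<in> du_ideal \<alpha> \<beta>"
  proof -
    define q where "q = fconst (1 / r)"
    have qr: "q * fconst r = 1" "q * (fconst r * x) = x" for x
      using inv[of 1] inv[of x] by (simp_all add: q_def)
    have q: "fu * q = q * fu" "fd * q = q * fd" "fu * (q * x) = q * (fu * x)"
      "fd * (q * x) = q * (fd * x)" for x
      by (simp_all add: q_def fconst_normalize)
    have "- 1 / r ^ 3 = - (1 / r * (1 / r * (1 / r)))" by (simp add: power3_eq_cube)
    then have q3: "fconst (- 1 / r ^ 3) = - (q * (q * q))"
      by (simp only: q_def fconst_uminus fconst_mult)
    have \<alpha>: "fconst \<alpha> = fconst r + fconst r" and \<beta>: "fconst \<beta> = - (fconst r * fconst r)"
      by (simp_all only: ab fconst_add fconst_uminus fconst_mult)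
    have "fu * (fu * fd) - (q * (fu * fd) + fconst (- 1 / r ^ 3) * lin_w \<beta> r) * fu
        = q * (q * (fd * fu * fu - (fconst \<alpha> * (fu * fd * fu) + fconst \<beta> * (fu * fu * fd))))"
      unfolding q3 w \<alpha> \<beta> by (simp add: algebra_simps fconst_normalize q qr)
    then show ?thesis unfolding q_def[symmetric] by (simp only: du_ideal_lmult du_rel_duu)
  qed
  have "fd * (fu * fd) - (fconst r * (fu * fd) + fconst (1 / r) * lin_w \<beta> r) * fd = 0"
    unfolding w inv by (simp add: algebra_simps)
  then show "fd * (fu * fd) - (fconst r * (fu * fd) + fconst (1 / r) * lin_w \<beta> r) * fd
      \<in> du_ideal \<alpha> \<beta>"
    by simp
qed

text \<open>The polynomial takes its value at 0 at every multiple of \<open>h\<close>, and in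
  characteristic zero there are infinitely many of these. A domain is the right generality: the
  lemma is used over the polynomials in w, with h = -2w.\<close>

lemma degree_0_if_shift_invariant:
  fixes P :: "'a::{idom, ring_char_0} poly"
  assumes "pcompose P [:h, 1:] = P" "h \<noteq> 0"
  shows "degree P = 0"
proof -
  have root: "poly (P - [:poly P 0:]) (of_nat k * h) = 0" for k
  proof (induction k)
    case (Suc k)
    have "poly P (of_nat (Suc k) * h) = poly (pcompose P [:h, 1:]) (of_nat k * h)"
      by (simp add: poly_pcompose algebra_simps)
    then show ?case using Suc by (simp only: assms(1)) simp
  qed simp
  have "inj (\<lambda>k. of_nat k * h)" using assms(2) by (auto intro!: injI)
  then have "infinite (Set.range (\<lambda>k. of_nat k * h))" by (simp add: finite_image_iff)
  then have "infinite {z. poly (P - [:poly P 0:]) z = 0}"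
    by (rule infinite_super[rotated]) (use root in auto)
  then have "P - [:poly P 0:] = 0" using poly_roots_finite by blast
  then show ?thesis by (metis degree_pCons_0 eq_iff_diff_eq_0)
qed

lemma lsub_fixed_double:
  fixes r :: "'k::field_char_0"
  assumes r: "r ^ 2 = 1" and fixed: "lsub (1 / r) (1 / r) (- 1 / r ^ 3) P = P"
    and c: "coeff (coeff P j) i \<noteq> 0"
  shows "j = 0" "r ^ i = 1"
proof -
  have r0: "r \<noteq> 0" and rr: "r * r = 1" using r by (auto simp: power2_eq_square)
  have inv: "1 / r = r" "- 1 / r ^ 3 = - r"
    using rr r0 by (simp_all add: field_simps power3_eq_cube)
  \<comment> \<open>Squaring removes the scaling by r, and the mixed coefficient of the square is r
    (-r) + (-r) r = -2.\<close>
  have "lsub 1 1 (- 2) P = P"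
    using lsub_compose[of r r "- r" r r "- r" P] fixed[unfolded inv(2), unfolded inv(1)] rr
    by simp
  moreover have "lsub 1 1 (- 2) P = pcompose P [:[:0, - 2:], 1:]"
    unfolding lsub_def pcompose_idR map_poly_id' by (simp only: pCons_one)
  ultimately have "degree P = 0"
    by (intro degree_0_if_shift_invariant[of P "[:0, - 2:]"]) simp_all
  then obtain p where p: "P = [:p:]" by (rule degree_eq_zeroE)
  then show "j = 0" using c by (cases j) (simp_all add: coeff_pCons)
  then have "coeff (pcompose p [:0, r:]) i = coeff p i" "coeff p i \<noteq> 0"
    using fixed c by (simp_all add: p inv)
  then show "r ^ i = 1" by (simp add: coeff_pcompose_linear)
qed

lemma HH3_basis_double:
  fixes r :: "'k::field_char_0"
  assumes r: "r ^ 2 = 1" and ab: "\<alpha> = r + r" "\<beta> = - 1"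
  shows "vectorspace.basis class_ring (HH3 \<alpha> \<beta>)
    ((\<lambda>i. free_tensor \<alpha> \<beta> (lin_w \<beta> r ^ i)) ` {i. r ^ i = 1})"
proof -
  have r0: "r \<noteq> 0" and rr: "r * r = 1" using r by (auto simp: power2_eq_square)
  interpret du_model \<alpha> \<beta> "1 / r" "1 / r" "- 1 / r ^ 3" r r "1 / r" "Y_double r"
    "lin_w \<beta> r" "fu * fd" \<beta> r 1 0 0 1 "1 / r" r
    using r0 rr ab by (intro du_model_double) simp_all
  let ?J = "(\<lambda>i. (i, 0 :: nat, 0 :: int)) ` {i. r ^ i = 1}"
  have "vectorspace.basis class_ring (HH3 \<alpha> \<beta>) ((\<lambda>t. free_tensor \<alpha> \<beta> (N t)) ` ?J)"
  proof (rule HH3_basis_fixed[OF ab(2)])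
    fix i j :: nat and n :: int assume "(i, j, n) \<in> ?J"
    then have "j = 0" "n = 0" "r ^ i = 1" by auto
    moreover from this have "pcompose (monom 1 i) [:0, 1 / r:] = monom 1 i"
      using r0 by (intro poly_eqI) (auto simp: coeff_pcompose_linear power_divide)
    ultimately show "Y_double r n = Y_double r 0 \<and>
        lsub (1 / r) (1 / r) (- 1 / r ^ 3) (monom (monom 1 i) j) = monom (monom 1 i) j"
      by (simp add: monom_0)
  next
    fix P :: "'k poly poly" and i j :: nat and n :: int
    assume Y: "Y_double r n = Y_double r 0"
      and P: "lsub (1 / r) (1 / r) (- 1 / r ^ 3) P = P" and c: "coeff (coeff P j) i \<noteq> 0"
    \<comment> \<open>The coefficient of x forces r^(-n) = 1; after that the coefficient of w
      compares 1 - n with 1 and forces n = 0.\<close>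
    have "r powi (- n) = 1"
      using arg_cong[OF Y, of "\<lambda>P. coeff (coeff P 1) 0"] r0 by (simp add: Y_double_def)
    then have "n = 0"
      using arg_cong[OF Y, of "\<lambda>P. coeff (coeff P 0) 1"] r0 by (simp add: Y_double_def)
    then show "(i, j, n) \<in> ?J" using lsub_fixed_double[OF r P c] by simp
  qed
  then show ?thesis by (simp add: N_def G_def image_image)
qed

section \<open>The case \<open>\<beta> = 0\<close>\<close>

text \<open>
  For \<open>\<beta> = 0\<close> the algebra has zero divisors and does not embed into a skew Laurent ring, so left
  multiplication is represented on the basis \<open>u\<^sup>i (du)\<^sup>j d\<^sup>k\<close> instead, a function standing for its
  family of coefficients.
\<close>

definition monomial_up ::
    "(nat \<times> nat \<times> nat \<Rightarrow> 'k::field_char_0) \<Rightarrow> nat \<times> nat \<times> nat \<Rightarrow> 'k" where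
  "monomial_up f = (\<lambda>(i, j, k). if i = 0 then 0 else f (i - 1, j, k))"

text \<open>For \<beta> = 0, d (du)^j d^k = \<alpha>^j (du)^j d^(k+1), and d u^(i+1) (du)^j d^k =
  \<alpha>^i u^i (du)^(j+1) d^k. The formula collects the coefficients at the target index, so the
  shifts are reversed.\<close>

definition monomial_down ::
    "'k \<Rightarrow> (nat \<times> nat \<times> nat \<Rightarrow> 'k::field_char_0) \<Rightarrow> nat \<times> nat \<times> nat \<Rightarrow> 'k" where
  "monomial_down \<alpha> f = (\<lambda>(i, j, k).
    (if i = 0 \<and> k > 0 then \<alpha> ^ j * f (0, j, k - 1) else 0) +
    (if j > 0 then \<alpha> ^ i * f (i + 1, j - 1, k) else 0))"

definition monomial_scale ::
    "'k \<Rightarrow> (nat \<times> nat \<times> nat \<Rightarrow> 'k::field_char_0) \<Rightarrow> nat \<times> nat \<times> nat \<Rightarrow> 'k" where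
  "monomial_scale c f = (\<lambda>t. c * f t)"

definition monomial_unit :: "nat \<times> nat \<times> nat \<Rightarrow> nat \<times> nat \<times> nat \<Rightarrow> 'k::field_char_0" where
  "monomial_unit t = (\<lambda>s. if s = t then 1 else 0)"

definition pbw_monomial :: "nat \<times> nat \<times> nat \<Rightarrow> 'k::field_char_0 free_alg" where
  "pbw_monomial = (\<lambda>(i, j, k). fu ^ i * (fd * fu) ^ j * fd ^ k)"

lemma free_alg_rep_monomial: "free_alg_rep monomial_scale monomial_up (monomial_down \<alpha>)"
  by unfold_locales
     (auto simp: monomial_scale_def monomial_up_def monomial_down_def fun_eq_iff algebra_simps)

lemma du_pow_fu: "(fd * fu) * fu ^ i - fconst (\<alpha> ^ i) * (fu ^ i * (fd * fu)) \<in> du_ideal \<alpha> 0"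
proof (induction i)
  case (Suc i)
  have "(fd * fu) * fu ^ Suc i - fconst (\<alpha> ^ Suc i) * (fu ^ Suc i * (fd * fu))
      = (fd * fu * fu - (fconst \<alpha> * (fu * fd * fu) + fconst 0 * (fu * fu * fd))) * fu ^ i
        + fconst \<alpha> * (fu * ((fd * fu) * fu ^ i - fconst (\<alpha> ^ i) * (fu ^ i * (fd * fu))))"
    by (simp add: algebra_simps fconst_mult fconst_normalize)
  then show ?case
    by (simp only: du_ideal_add du_ideal_rmult du_ideal_lmult du_rel_duu Suc)
qed simp

lemma fd_pow_du: "fd * (fd * fu) ^ j - fconst (\<alpha> ^ j) * ((fd * fu) ^ j * fd) \<in> du_ideal \<alpha> 0"
proof (induction j)
  case (Suc j)
  have "fd * (fd * fu) ^ Suc j - fconst (\<alpha> ^ Suc j) * ((fd * fu) ^ Suc j * fd)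
      = (fd * fd * fu - (fconst \<alpha> * (fd * fu * fd) + fconst 0 * (fu * fd * fd))) * (fd * fu) ^ j
        + fconst \<alpha> * (fd * fu * (fd * (fd * fu) ^ j - fconst (\<alpha> ^ j) * ((fd * fu) ^ j * fd)))"
    by (simp add: algebra_simps fconst_mult fconst_normalize)
  then show ?case
    by (simp only: du_ideal_add du_ideal_rmult du_ideal_lmult du_rel_ddu Suc)
qed simp

lemma pbw_monomial_span:
  fixes x :: "'k::field_char_0 free_alg"
  shows "x \<in> free_alg.span (du_ideal \<alpha> 0 \<union> Set.range pbw_monomial)"
proof -
  let ?K = "free_alg.span (du_ideal \<alpha> 0 \<union> Set.range pbw_monomial)"
  have ideal: "y \<in> du_ideal \<alpha> 0 \<Longrightarrow> y \<in> ?K" for y by (simp add: free_alg.span_base)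
  have unit: "pbw_monomial t \<in> ?K" for t by (simp add: free_alg.span_base)
  have up: "fu * pbw_monomial t \<in> ?K" for t
  proof -
    obtain i j k where t: "t = (i, j, k)" by (cases t)
    have "fu * pbw_monomial t = (pbw_monomial (Suc i, j, k) :: 'k free_alg)" by (simp add: t pbw_monomial_def mult.assoc)
    then show ?thesis by (simp add: unit)
  qed
  have down: "fd * pbw_monomial t \<in> ?K" for t
  proof -
    obtain i j k where t: "t = (i, j, k)" by (cases t)
    show ?thesis
    proof (cases i)
      case 0
      have "fd * pbw_monomial t
          = (fd * (fd * fu) ^ j - fconst (\<alpha> ^ j) * ((fd * fu) ^ j * fd)) * fd ^ k
            + fconst (\<alpha> ^ j) * pbw_monomial (0, j, Suc k)"
        by (simp add: t 0 pbw_monomial_def algebra_simps)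
      moreover have "(fd * (fd * fu) ^ j - fconst (\<alpha> ^ j) * ((fd * fu) ^ j * fd)) * fd ^ k \<in> ?K"
        by (intro ideal du_ideal_rmult fd_pow_du)
      ultimately show ?thesis by (simp only: free_alg.span_add free_alg.span_scale unit)
    next
      case (Suc m)
      have "fd * pbw_monomial t
          = ((fd * fu) * fu ^ m - fconst (\<alpha> ^ m) * (fu ^ m * (fd * fu))) * ((fd * fu) ^ j * fd ^ k)
            + fconst (\<alpha> ^ m) * pbw_monomial (m, Suc j, k)"
        by (simp add: t Suc pbw_monomial_def algebra_simps)
      moreover have "((fd * fu) * fu ^ m - fconst (\<alpha> ^ m) * (fu ^ m * (fd * fu)))
          * ((fd * fu) ^ j * fd ^ k) \<in> ?K"
        by (intro ideal du_ideal_rmult du_pow_fu)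
      ultimately show ?thesis by (simp only: free_alg.span_add free_alg.span_scale unit)
    qed
  qed
  have closed: "l * x \<in> ?K" if "x \<in> ?K" and l: "\<And>t. l * pbw_monomial t \<in> ?K" for l x
    using that(1)
  proof (induction rule: free_alg.span_induct_alt)
    case (step c x y)
    have "l * x \<in> ?K" using step(1) l by (auto intro: ideal du_ideal_lmult)
    then show ?case using step(2)
      by (simp only: distrib_left fconst_left_commute[of l] free_alg.span_add free_alg.span_scale)
  qed (simp add: free_alg.span_zero)
  show ?thesis
  proof (induction x rule: free_alg_induct)
    case one
    show ?case using unit[of "(0, 0, 0)"] by (simp add: pbw_monomial_def)
  qed (simp_all add: free_alg.span_add free_alg.span_scale closed up down)
qed

text \<open>Left multiplication by u only raises the first exponent of a basis monomial, hence is
  injective on coefficient families.\<close>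

lemma fu_left_cancel_beta_0:
  assumes "fu * x \<in> du_ideal \<alpha> 0"
  shows "x \<in> du_ideal \<alpha> 0"
proof -
  interpret free_alg_rep monomial_scale monomial_up "monomial_down \<alpha>"
    by (rule free_alg_rep_monomial)
  have act_0: "act y f = 0" if "y \<in> du_ideal \<alpha> 0" for y f
  proof (rule act_du_ideal[OF _ _ that])
    let ?U = monomial_up and ?D = "monomial_down \<alpha>"
    note defs = monomial_scale_def monomial_up_def monomial_down_def
    show "?D (?D (?U f)) = monomial_scale \<alpha> (?D (?U (?D f))) + monomial_scale 0 (?U (?D (?D f)))"
      for f
    proof
      fix s :: "nat \<times> nat \<times> nat"
      obtain i j k where s: "s = (i, j, k)" by (cases s)
      show "?D (?D (?U f)) s
          = (monomial_scale \<alpha> (?D (?U (?D f))) + monomial_scale 0 (?U (?D (?D f)))) s"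
        unfolding s by (cases j) (simp_all add: defs distrib_left mult.left_commute)
    qed
    show "?D (?U (?U f)) = monomial_scale \<alpha> (?U (?D (?U f))) + monomial_scale 0 (?U (?U (?D f)))"
      for f
    proof
      fix s :: "nat \<times> nat \<times> nat"
      obtain i j k where s: "s = (i, j, k)" by (cases s)
      show "?D (?U (?U f)) s
          = (monomial_scale \<alpha> (?U (?D (?U f))) + monomial_scale 0 (?U (?U (?D f)))) s"
        unfolding s by (cases i) (simp_all add: defs)
    qed
  qed
  \<comment> \<open>Each monomial sends the vector of 1 to its own unit vector, so evaluation at
    that vector gives independence of the monomials modulo the ideal.\<close>
  have unit: "act (pbw_monomial t) (monomial_unit (0, 0, 0)) = monomial_unit t" for t
  proof -
    obtain i j k where t: "t = (i, j, k)" by (cases t)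
    have up: "monomial_up (monomial_unit (i, j, k)) = monomial_unit (Suc i, j, k)" for i j k
      by (auto simp: monomial_up_def monomial_unit_def fun_eq_iff)
    have down: "monomial_down \<alpha> (monomial_unit (0, 0, k)) = monomial_unit (0, 0, Suc k)" for k
      by (auto simp: monomial_down_def monomial_unit_def fun_eq_iff)
    have down_up: "monomial_down \<alpha> (monomial_unit (Suc 0, j, k)) = monomial_unit (0, Suc j, k)"
      for j k
      by (auto simp: monomial_down_def monomial_unit_def fun_eq_iff)
    have k: "act (fd ^ k) (monomial_unit (0, 0, 0)) = monomial_unit (0, 0, k)"
      by (induction k) (simp_all add: down)
    have j: "act ((fd * fu) ^ j) (monomial_unit (0, 0, k)) = monomial_unit (0, j, k)"
      by (induction j) (simp_all add: act_mult up down_up)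
    have i: "act (fu ^ i) (monomial_unit (0, j, k)) = monomial_unit (i, j, k)"
      by (induction i) (simp_all add: up)
    show ?thesis by (simp add: t pbw_monomial_def act_mult i j k)
  qed
  let ?ev = "\<lambda>x. act x (monomial_unit (0, 0, 0))"
  have "monomial_up (?ev x) = 0" using act_0[OF assms] by simp
  \<comment> \<open>Evaluating at \<open>Suc i\<close> avoids the default value 0 at first index 0
    and recovers every coefficient of \<open>?ev x\<close>.\<close>
  then have "monomial_up (?ev x) (Suc i, j, k) = 0" for i j k by simp
  then have ev: "?ev x = 0" by (auto simp: monomial_up_def fun_eq_iff)
  obtain T c where T: "finite T" "x - (\<Sum>t\<in>T. fconst (c t) * pbw_monomial t) \<in> du_ideal \<alpha> 0"
    using span_mod_ideal[OF pbw_monomial_span] by blast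
  have "c s = 0" if "s \<in> T" for s
  proof -
    have "(\<Sum>t\<in>T. h t) s = (\<Sum>t\<in>T. h t s)" for h :: "_ \<Rightarrow> nat \<times> nat \<times> nat \<Rightarrow> 'a"
      by (induction T rule: infinite_finite_induct) simp_all
    moreover have "?ev (\<Sum>t\<in>T. fconst (c t) * pbw_monomial t) = 0"
      using act_0[OF T(2), of "monomial_unit (0, 0, 0)"] ev by (simp add: act_diff_left)
    then have "(\<Sum>t\<in>T. monomial_scale (c t) (monomial_unit t)) = 0"
      by (simp only: act_sum_left act_scale_left unit)
    ultimately have "(\<Sum>t\<in>T. monomial_scale (c t) (monomial_unit t) s) = 0"
      by (metis zero_fun_apply)
    then show ?thesis
      using T(1) that by (simp add: monomial_scale_def monomial_unit_def sum.delta if_distrib cong: if_cong)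
  qed
  then show ?thesis using T(2) by simp
qed

section \<open>The computation of the homology\<close>

lemma cycle3_trivial_F1:
  fixes r1 r2 :: "'k::field_char_0"
  assumes ab: "\<alpha> = r1 + r2" "\<beta> = - (r1 * r2)" and F1: "family_F1 \<alpha> \<beta> r1 r2"
    and x: "cycle3 \<alpha> \<beta> x"
  shows "x \<in> du_ideal \<alpha> \<beta>"
proof (cases "\<beta> = 0")
  case True
  then show ?thesis using x fu_left_cancel_beta_0[of x \<alpha>] by (simp add: cycle3_def)
next
  case False
  then have r: "r1 \<noteq> 0" "r2 \<noteq> 0" using ab by auto
  \<comment> \<open>As -\<beta> = r1 r2, equality would give a relation with both exponents raised
    by one, which (F1) excludes.\<close>
  have eig: "(1 / r2) ^ j * (1 / r1) ^ i \<noteq> - \<beta>" for i j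
  proof
    assume "(1 / r2) ^ j * (1 / r1) ^ i = - \<beta>"
    then have "r1 ^ Suc i * r2 ^ Suc j = 1"
      using r by (simp add: ab power_divide field_simps)
    moreover have "(Suc i, Suc j) \<noteq> (0, 0)" by simp
    ultimately show False using F1 unfolding family_F1_def by blast
  qed
  show ?thesis
  proof (cases "r1 = r2")
    case True
    interpret du_model \<alpha> \<beta> "1 / r1" "1 / r1" "- 1 / r1 ^ 3" r1 r1 "1 / r1" "Y_double r1"
      "lin_w \<beta> r1" "fu * fd" \<beta> r1 1 0 0 1 "1 / r1" r1
      using r ab True by (intro du_model_double) simp_all
    show ?thesis using cycle3_trivial[OF _ x] eig True by simp
  next
    case False
    interpret du_model \<alpha> \<beta> "1 / r1" "1 / r2" 0 r1 r2 0 "Y_distinct r1 r2" "lin_w \<beta> r1"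
      "lin_w \<beta> r2" \<beta> r1 \<beta> r2 "1 / (r1 * (r1 - r2))" "- 1 / (r2 * (r1 - r2))"
      "1 / (r1 - r2)" "- 1 / (r1 - r2)"
      using r ab False by (intro du_model_distinct) simp_all
    show ?thesis using cycle3_trivial[OF eig x] .
  qed
qed

lemma power_eq_iff_not_root_of_unity:
  fixes r :: "'k::field_char_0"
  assumes "r \<noteq> 0" "\<not> root_of_unity r"
  shows "r ^ i = r ^ j \<longleftrightarrow> i = j" and "r powi n = 1 \<longleftrightarrow> n = 0"
proof -
  have pos: "r ^ m \<noteq> 1" if "m > 0" for m using assms(2) that unfolding root_of_unity_def by blast
  have less: "r ^ i \<noteq> r ^ j" if "i < j" for i j
  proof
    assume "r ^ i = r ^ j"
    moreover have "r ^ j = r ^ i * r ^ (j - i)" using that by (simp flip: power_add)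
    ultimately show False using pos[of "j - i"] assms(1) that by simp
  qed
  show "r ^ i = r ^ j \<longleftrightarrow> i = j" using less[of i j] less[of j i] by (metis linorder_neqE_nat)
  show "r powi n = 1 \<longleftrightarrow> n = 0"
    using pos[of "nat n"] pos[of "nat (- n)"] assms(1)
    by (cases n "0 :: int" rule: linorder_cases) (auto simp: power_int_def power_inverse)
qed

lemma powi_eq_1_iff_primitive:
  fixes r :: "'k::field_char_0"
  assumes "primitive_root_of_unity n r"
  shows "r powi m = 1 \<longleftrightarrow> int n dvd m"
proof -
  have n: "n > 0" "r ^ n = 1" "\<And>m. 0 < m \<Longrightarrow> m < n \<Longrightarrow> r ^ m \<noteq> 1"
    using assms by (auto simp: primitive_root_of_unity_def)
  have r: "r \<noteq> 0" using n(1,2) by (auto simp: power_0_left)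
  \<comment> \<open>Only the remainder modulo \<open>n\<close> matters, and minimality of
    \<open>n\<close> rules out a nonzero one.\<close>
  define q where "q = nat (m mod int n)"
  have q: "int q = m mod int n" "q < n" using n(1) by (simp_all add: q_def nat_less_iff)
  have "r powi m = r powi (int n * (m div int n) + int q)" by (simp add: q(1))
  also have "\<dots> = (r powi int n) powi (m div int n) * r ^ q"
    using r by (simp add: power_int_add power_int_mult)
  also have "\<dots> = r ^ q" using n(2) by simp
  finally have "r powi m = 1 \<longleftrightarrow> q = 0" using n(3)[of q] q(2) by auto
  also have "\<dots> \<longleftrightarrow> int n dvd m" using q(1) by (auto simp: dvd_eq_mod_eq_0)
  finally show ?thesis .
qed

lemma power_eq_iff_primitive:
  fixes r :: "'k::field_char_0"
  assumes "primitive_root_of_unity n r"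
  shows "r ^ i = r ^ j \<longleftrightarrow> int n dvd int i - int j"
proof -
  have r: "r \<noteq> 0" using assms by (auto simp: primitive_root_of_unity_def power_0_left)
  have "r powi (int i - int j) = r ^ i / r ^ j" using r by (simp add: power_int_diff)
  then have "r ^ i = r ^ j \<longleftrightarrow> r powi (int i - int j) = 1" using r by simp
  then show ?thesis by (simp add: powi_eq_1_iff_primitive[OF assms])
qed

theorem proposition3p6:
  fixes \<alpha> \<beta> r1 r2 :: "'k::field_char_0"
  assumes nonzero: "(\<alpha>, \<beta>) \<noteq> (0, 0)"
    and roots: "[:- \<beta>, - \<alpha>, 1:] = [:- r1, 1:] * [:- r2, 1:]"
    and r1: "r1 \<noteq> 0"
  defines "A \<equiv> down_up_algebra \<alpha> \<beta>"
    and "u \<equiv> du_u \<alpha> \<beta>"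
    and "d \<equiv> du_d \<alpha> \<beta>"
    and "w1 \<equiv> du_w \<alpha> \<beta> r1"
    and "w2 \<equiv> du_w \<alpha> \<beta> r2"
  shows "(family_F1 \<alpha> \<beta> r1 r2 \<longrightarrow> carrier (HH3 \<alpha> \<beta>) = {\<zero>\<^bsub>HH3 \<alpha> \<beta>\<^esub>}) \<and>
    (family_F2 \<beta> \<longrightarrow>
      (\<not> root_of_unity r1 \<longrightarrow>
        vectorspace.basis class_ring (HH3 \<alpha> \<beta>)
          {Omega_tensor \<alpha> \<beta> (w1 [^]\<^bsub>A\<^esub> i \<otimes>\<^bsub>A\<^esub> w2 [^]\<^bsub>A\<^esub> i) | i :: nat. True}) \<and>
      (\<forall>n \<ge> 3. primitive_root_of_unity n r1 \<longrightarrow>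
        vectorspace.basis class_ring (HH3 \<alpha> \<beta>)
          {Omega_tensor \<alpha> \<beta>
             (w1 [^]\<^bsub>A\<^esub> i \<otimes>\<^bsub>A\<^esub> w2 [^]\<^bsub>A\<^esub> j \<otimes>\<^bsub>A\<^esub> u [^]\<^bsub>A\<^esub> (n * k) \<otimes>\<^bsub>A\<^esub> d [^]\<^bsub>A\<^esub> (n * l))
           | i j k l :: nat. int n dvd int i - int j \<and> k * l = 0}) \<and>
      (r1 = - 1 \<longrightarrow>
        vectorspace.basis class_ring (HH3 \<alpha> \<beta>)
          {Omega_tensor \<alpha> \<beta> (w1 [^]\<^bsub>A\<^esub> (2 * i)) | i :: nat. True}) \<and>
      (r1 = 1 \<longrightarrow>
        vectorspace.basis class_ring (HH3 \<alpha> \<beta>)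
          {Omega_tensor \<alpha> \<beta> (w1 [^]\<^bsub>A\<^esub> i) | i :: nat. True}))"
proof -
  have ab: "\<alpha> = r1 + r2" "\<beta> = - (r1 * r2)"
    using roots by (simp_all add: neg_eq_iff_add_eq_0 algebra_simps eq_neg_iff_add_eq_0)
  note tensor = A_def u_def d_def w1_def w2_def du_w_eq du_u_def du_d_def down_up_pow down_up_mult
    free_tensor_def[symmetric]
  let ?w1 = "lin_w \<beta> r1" and ?w2 = "lin_w \<beta> r2"
  show ?thesis
  proof (intro conjI impI allI)
    assume F1: "family_F1 \<alpha> \<beta> r1 r2"
    have "free_tensor \<alpha> \<beta> x = free_tensor \<alpha> \<beta> 0" if "cycle3 \<alpha> \<beta> x" for x
      using cycle3_trivial_F1[OF ab F1 that] by (simp add: free_tensor_eq_iff)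
    then show "carrier (HH3 \<alpha> \<beta>) = {\<zero>\<^bsub>HH3 \<alpha> \<beta>\<^esub>}"
      unfolding carrier_HH3 HH3_zero using cycle3_zero[of \<alpha> \<beta>] by blast
  next
    assume F2: "family_F2 \<beta>" and r: "\<not> root_of_unity r1"
    have prod: "r1 * r2 = 1" and \<beta>: "\<beta> = - 1" using F2 ab by (auto simp: family_F2_def)
    \<comment> \<open>At \<beta> = -1 the roots are mutually inverse, so a double root would square
      to 1.\<close>
    have "r1 \<noteq> r2"
    proof
      assume "r1 = r2"
      then have "r1 ^ 2 = 1" using prod by (simp add: power2_eq_square)
      then show False using r unfolding root_of_unity_def by (metis zero_less_numeral)
    qed
    note basis = HH3_basis_distinct[OF r1 this prod ab(1) \<beta>]
    have "{Omega_tensor \<alpha> \<beta> (w1 [^]\<^bsub>A\<^esub> i \<otimes>\<^bsub>A\<^esub> w2 [^]\<^bsub>A\<^esub> i) | i :: nat. True}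
        = (\<lambda>(i, j, n). free_tensor \<alpha> \<beta> (?w1 ^ i * ?w2 ^ j *
            (if n \<ge> 0 then fu ^ nat n else fd ^ nat (- n)))) `
          {(i, j, n). r1 ^ i = r1 ^ j \<and> r1 powi n = 1}"
      using power_eq_iff_not_root_of_unity[OF r1 r] by (auto simp: tensor image_iff)
    then show "vectorspace.basis class_ring (HH3 \<alpha> \<beta>)
        {Omega_tensor \<alpha> \<beta> (w1 [^]\<^bsub>A\<^esub> i \<otimes>\<^bsub>A\<^esub> w2 [^]\<^bsub>A\<^esub> i) | i :: nat. True}"
      using basis by simp
  next
    fix n :: nat
    assume F2: "family_F2 \<beta>" and n: "n \<ge> 3" and r: "primitive_root_of_unity n r1"
    have prod: "r1 * r2 = 1" and \<beta>: "\<beta> = - 1" using F2 ab by (auto simp: family_F2_def)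
    \<comment> \<open>This is where n \<ge> 3 enters: a double root would have order at most
      2.\<close>
    have "r1 \<noteq> r2"
    proof
      assume "r1 = r2"
      then have "r1 ^ 2 = 1" using prod by (simp add: power2_eq_square)
      then show False using r n by (auto simp: primitive_root_of_unity_def)
    qed
    note basis = HH3_basis_distinct[OF r1 this prod ab(1) \<beta>]
    define gm :: "int \<Rightarrow> 'k free_alg"
      where "gm = (\<lambda>m. if m \<ge> 0 then fu ^ nat m else fd ^ nat (- m))"
    \<comment> \<open>Because one of \<open>k\<close>, \<open>l\<close> is zero, the pair amounts to
      the single integer exponent \<open>n\<close> times \<open>k - l\<close>.\<close>
    have g: "fu ^ (n * k) * fd ^ (n * l) = gm (int n * (int k - int l))" if "k * l = 0" for k l
    proof (cases "l = 0")
      case True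
      then show ?thesis by (simp add: gm_def nat_mult_distrib)
    next
      case False
      then have "k = 0" "int n * int l > 0" using that n by simp_all
      then show ?thesis by (simp add: gm_def nat_mult_distrib)
    qed
    have eq: "Omega_tensor \<alpha> \<beta>
          (w1 [^]\<^bsub>A\<^esub> i \<otimes>\<^bsub>A\<^esub> w2 [^]\<^bsub>A\<^esub> j \<otimes>\<^bsub>A\<^esub> u [^]\<^bsub>A\<^esub> (n * k) \<otimes>\<^bsub>A\<^esub> d [^]\<^bsub>A\<^esub> (n * l))
        = free_tensor \<alpha> \<beta> (?w1 ^ i * ?w2 ^ j * gm (int n * (int k - int l)))"
      if "k * l = 0" for i j k l
      unfolding g[OF that, symmetric] by (simp add: tensor mult.assoc)
    have "{Omega_tensor \<alpha> \<beta>
             (w1 [^]\<^bsub>A\<^esub> i \<otimes>\<^bsub>A\<^esub> w2 [^]\<^bsub>A\<^esub> j \<otimes>\<^bsub>A\<^esub> u [^]\<^bsub>A\<^esub> (n * k) \<otimes>\<^bsub>A\<^esub> d [^]\<^bsub>A\<^esub> (n * l))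
           | i j k l :: nat. int n dvd int i - int j \<and> k * l = 0}
        = {free_tensor \<alpha> \<beta> (?w1 ^ i * ?w2 ^ j * gm (int n * (int k - int l)))
           | i j k l :: nat. int n dvd int i - int j \<and> k * l = 0}"
      by (intro Collect_cong ex_cong1) (metis eq)
    also have "\<dots> = (\<lambda>(i, j, m). free_tensor \<alpha> \<beta> (?w1 ^ i * ?w2 ^ j * gm m)) `
          {(i, j, m). r1 ^ i = r1 ^ j \<and> r1 powi m = 1}" (is "?L = ?R")
    proof
      show "?L \<subseteq> ?R"
      proof
        fix z assume "z \<in> ?L"
        then obtain i j k l where "z = free_tensor \<alpha> \<beta> (?w1 ^ i * ?w2 ^ j * gm (int n * (int k - int l)))"
          and "int n dvd int i - int j" by blast
        then show "z \<in> ?R"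
          unfolding power_eq_iff_primitive[OF r] powi_eq_1_iff_primitive[OF r]
          by (intro image_eqI[of _ _ "(i, j, int n * (int k - int l))"]) simp_all
      qed
      show "?R \<subseteq> ?L"
      proof
        fix z assume "z \<in> ?R"
        then obtain i j q where z: "z = free_tensor \<alpha> \<beta> (?w1 ^ i * ?w2 ^ j * gm (int n * q))"
          and ij: "int n dvd int i - int j"
          unfolding power_eq_iff_primitive[OF r] powi_eq_1_iff_primitive[OF r]
          by (auto elim!: dvdE simp: dvd_def)
        \<comment> \<open>Conversely, the positive and negative parts of \<open>q\<close> serve as
          \<open>k\<close> and \<open>l\<close>.\<close>
        have "z = free_tensor \<alpha> \<beta> (?w1 ^ i * ?w2 ^ j * gm (int n * (int (nat q) - int (nat (- q)))))"
          using z by simp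
        moreover have "nat q * nat (- q) = 0" by auto
        ultimately show "z \<in> ?L" using ij by blast
      qed
    qed
    finally show "vectorspace.basis class_ring (HH3 \<alpha> \<beta>)
        {Omega_tensor \<alpha> \<beta>
             (w1 [^]\<^bsub>A\<^esub> i \<otimes>\<^bsub>A\<^esub> w2 [^]\<^bsub>A\<^esub> j \<otimes>\<^bsub>A\<^esub> u [^]\<^bsub>A\<^esub> (n * k) \<otimes>\<^bsub>A\<^esub> d [^]\<^bsub>A\<^esub> (n * l))
           | i j k l :: nat. int n dvd int i - int j \<and> k * l = 0}"
      using basis by (simp add: gm_def)
  next
    assume F2: "family_F2 \<beta>" and r: "r1 = - 1"
    have "\<beta> = - 1" "r2 = r1" using F2 ab r by (auto simp: family_F2_def)
    then have basis: "vectorspace.basis class_ring (HH3 \<alpha> \<beta>)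
        ((\<lambda>i. free_tensor \<alpha> \<beta> (?w1 ^ i)) ` {i. r1 ^ i = 1})"
      using ab r by (intro HH3_basis_double) simp_all
    \<comment> \<open>The automorphism scales w1 by -1, so exactly the even powers are
      invariant.\<close>
    have "{i. r1 ^ i = 1} = Set.range (\<lambda>i. 2 * i)"
      using r by (auto simp: minus_one_power_iff elim!: evenE split: if_splits)
    then show "vectorspace.basis class_ring (HH3 \<alpha> \<beta>)
        {Omega_tensor \<alpha> \<beta> (w1 [^]\<^bsub>A\<^esub> (2 * i)) | i :: nat. True}"
      using basis by (simp add: tensor image_image full_SetCompr_eq)
  next
    assume F2: "family_F2 \<beta>" and r: "r1 = 1"
    have "\<beta> = - 1" "r2 = r1" using F2 ab r by (auto simp: family_F2_def)
    then have "vectorspace.basis class_ring (HH3 \<alpha> \<beta>)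
        ((\<lambda>i. free_tensor \<alpha> \<beta> (?w1 ^ i)) ` {i. r1 ^ i = 1})"
      using ab r by (intro HH3_basis_double) simp_all
    then show "vectorspace.basis class_ring (HH3 \<alpha> \<beta>)
        {Omega_tensor \<alpha> \<beta> (w1 [^]\<^bsub>A\<^esub> i) | i :: nat. True}"
      using r by (simp add: tensor full_SetCompr_eq)
  qed
qed

end
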